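(* Let $n\ge 3$ and $m\ge 4$ be integers, let $\overline w=(w_0,\dots,w_{n-1})$ with all $w_i\ge 0$ and $w_0>0$, and put $w=w_0+\cdots+w_{n-1}$. For integers $0\le l\le n$ put $\alpha_l = 2\left(1-\cos\frac{l\pi}{n}\right)$, and put $\beta^{-}_{m,w}=\frac12\left[m+w-\sqrt{(m+w)^2-4w}\right]$. Assume $\beta^{-}_{m,w}\notin\{\alpha_l : 0\le l\le n\}$. For a modification $\overline\delta=(\delta_0,\dots,\delta_{m-1})\neq 0$ with all $\delta_i\ge 0$, put $\delta=\delta_0+\cdots+\delta_{m-1}$ and $$S=\delta-\frac{\delta-\delta_0\alpha_2}{\alpha_2^2-(m+w)\alpha_2+w}\sum_{i=0}^{n-1}w_i\cos\frac{2i\pi}{n};$$ let $L_G$ be the Laplacian of the unmodified graph of Model III and $L_{G_p}=L_G(\overline\delta)$ the Laplacian of the modified graph of Model III (both written out explicitly in the context). Then the following hold. (i) (Local modification) If $\overline\delta\neq 0$ is sufficiently small (i.e. there is $\varepsilon>0$ such that the following holds for all modifications with $0<\delta<\varepsilon$), then all the eigenvalues of $L_{G_p}$ are real, and, with $\theta=\pi-\cos^{-1}\left(\frac{\beta^{-}_{m,w}-2}{2}\right)$: (a) if $\alpha_2<\beta^{-}_{m,w}$ and $S<0$, then $\lambda_2(L_{G_p})<\lambda_2(L_G)$; (b) if $\alpha_2<\beta^{-}_{m,w}$ and $S>0$, then $\lambda_2(L_{G_p})=\lambda_2(L_G)$; (c) if $0<\beta^{-}_{m,w}<\alpha_1$,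 then $\lambda_2(L_{G_p})>\lambda_2(L_G)$; (d) if $\alpha_1<\beta^{-}_{m,w}<\alpha_2$ and $\sum_{i=0}^{n-1}w_i\cos\left(\left(\frac n2-i\right)\theta\right)>0$, then $\lambda_2(L_{G_p})>\lambda_2(L_G)$; (e) if $\alpha_1<\beta^{-}_{m,w}<\alpha_2$ and $\sum_{i=0}^{n-1}w_i\cos\left(\left(\frac n2-i\right)\theta\right)<0$, then $\lambda_2(L_{G_p})<\lambda_2(L_G)$. (ii) (Global modification) Let $\overline\delta\neq0$ be an arbitrary modification and assume $\alpha_2<\beta^{-}_{m,w}$. (a) If $S<0$, then $\mathrm{Re}\left(\lambda_2(L_{G_p})\right)<\lambda_2(L_G)$. (b) If $S>0$, then $\mathrm{Re}\left(\lambda_2(L_{G_p})\right)\le\lambda_2(L_G)$.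
   Context: Laplacian convention: for a weighted digraph with adjacency matrix $A=(A_{ij})$, $A_{ij}\ge 0$ being the weight of the edge from node $j$ to node $i$, the Laplacian is $L=D-A$, where $D$ is diagonal with $D_{ii}=\sum_j A_{ij}$. Model III: the unmodified graph $G$ consists of an undirected cycle $C_n$ with nodes $0,\dots,n-1$, an undirected star $S_m$ with $m$ nodes $0,\dots,m-1$ (node $0$ is the hub, the others are leaves), all these edges having weight $1$, and, for each $0\le i\le n-1$, a directed edge of weight $w_i\ge 0$ from node $i$ of the cycle to the hub of the star. The modified graph $G_p$ is obtained by adding, for each $0\le i\le m-1$, a directed edge of weight $\delta_i\ge0$ from node $i$ of the star to node $0$ of the cycle. Explicitly, ordering the cycle nodes first and then the star nodes, these are the $(n+m)\times(n+m)$ real matrices $$L_G=\begin{pmatrix} L_{C_n} & 0\\ -C & L_{S_m}+D_C\end{pmatrix},\qquad L_{G_p}=\begin{pmatrix} L_{C_n}+D_\Delta & -\Delta\\ -C & L_{S_m}+D_C\end{pmatrix},$$ where $L_{C_n}$ is the Laplacian of the cycle ($2$ on the diagonal, $-1$ at cyclically adjacent pairs), $L_{S_m}=\begin{pmatrix} m-1 & -\mathbf 1_{m-1}^{\top}\\ -\mathbf 1_{m-1} & I_{m-1}\end{pmatrix}$ (with $\mathbf 1_{k}$ the all-ones vector in $\mathbb R^k$), $C$ is the $m\times n$ matrix whose first row is $(w_0,\dots,w_{n-1})$ and whose other rows are zero, $D_C$ is the $m\times m$ matrix whose only nonzero entry is its top-left entry, equal to $w$, $\Delta$ is the $n\times m$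 matrix whose first row is $(\delta_0,\delta_1,\dots,\delta_{m-1})$ and whose other rows are zero, and $D_\Delta$ is the $n\times n$ matrix whose only nonzero entry is its top-left entry, equal to $\delta$. Spectral gap: for each of these Laplacians $0$ is a simple eigenvalue and all other eigenvalues have positive real part. Listing the eigenvalues with algebraic multiplicity as $0=\lambda_1<\mathrm{Re}(\lambda_2)\le \mathrm{Re}(\lambda_3)\le\cdots$, $\lambda_2(L)$ denotes the second one in this ordering by real parts. All eigenvalues of $L_G$ are real. *)

theory Defs
  imports "Jordan_Normal_Form.Spectral_Radius" "HOL-Computational_Algebra.Fundamental_Theorem_Algebra"
begin

(* An adjacency matrix A stores in A $$ (i, j) the weight of the edge from j to i,
   so the diagonal part of the Laplacian consists of the row sums. *)
definition laplacian :: "real mat \<Rightarrow> real mat" where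
  "laplacian A = mat_diag (dim_row A) (\<lambda>i. \<Sum>j<dim_col A. A $$ (i, j)) - A"

definition cycle_adj :: "nat \<Rightarrow> real mat" where
  "cycle_adj n = mat n n (\<lambda>(i, j). if j = Suc i mod n \<or> i = Suc j mod n then 1 else 0)"

definition star_adj :: "nat \<Rightarrow> real mat" where
  "star_adj m = mat m m (\<lambda>(i, j). if (i = 0) \<noteq> (j = 0) then 1 else 0)"

definition first_row_mat :: "nat \<Rightarrow> nat \<Rightarrow> (nat \<Rightarrow> real) \<Rightarrow> real mat" where
  "first_row_mat r c f = mat r c (\<lambda>(i, j). if i = 0 then f j else 0)"

definition corner_mat :: "nat \<Rightarrow> real \<Rightarrow> real mat" where
  "corner_mat k x = mat k k (\<lambda>(i, j). if i = 0 \<and> j = 0 then x else 0)"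

(* Nodes 0, ..., n-1 are those of the cycle; nodes n, ..., n+m-1 are those of the star,
   with hub n.  Only the values w i for i < n and \<delta> i for i < m are used. *)
definition adj_G :: "nat \<Rightarrow> nat \<Rightarrow> (nat \<Rightarrow> real) \<Rightarrow> real mat" where
  "adj_G n m w =
     four_block_mat (cycle_adj n) (0\<^sub>m n m) (first_row_mat m n w) (star_adj m)"

definition adj_Gp :: "nat \<Rightarrow> nat \<Rightarrow> (nat \<Rightarrow> real) \<Rightarrow> (nat \<Rightarrow> real) \<Rightarrow> real mat" where
  "adj_Gp n m w \<delta> =
     four_block_mat (cycle_adj n) (first_row_mat n m \<delta>) (first_row_mat m n w) (star_adj m)"

definition L_G :: "nat \<Rightarrow> nat \<Rightarrow> (nat \<Rightarrow> real) \<Rightarrow> real mat" where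
  "L_G n m w = laplacian (adj_G n m w)"

definition L_Gp :: "nat \<Rightarrow> nat \<Rightarrow> (nat \<Rightarrow> real) \<Rightarrow> (nat \<Rightarrow> real) \<Rightarrow> real mat" where
  "L_Gp n m w \<delta> = laplacian (adj_Gp n m w \<delta>)"

definition modification :: "nat \<Rightarrow> (nat \<Rightarrow> real) \<Rightarrow> bool" where
  "modification m \<delta> \<longleftrightarrow> (\<forall>i<m. \<delta> i \<ge> 0) \<and> (\<exists>i<m. \<delta> i \<noteq> 0)"

abbreviation complex_mat :: "real mat \<Rightarrow> complex mat" where
  "complex_mat A \<equiv> map_mat complex_of_real A"

(* The second entry (index 1) of a list of all complex eigenvalues, repeated according to
   algebraic multiplicity and ordered by real part.  The order among eigenvalues with the
   same real part is left unspecified; the real part of the result does not depend on it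
   (Re_lambda2 below). *)
definition lambda2 :: "real mat \<Rightarrow> complex" where
  "lambda2 A =
     sort_key Re (SOME es. mset es = proots (char_poly (complex_mat A))) ! 1"

definition alpha :: "nat \<Rightarrow> nat \<Rightarrow> real" where
  "alpha n l = 2 * (1 - cos (real l * pi / real n))"

definition beta_minus :: "nat \<Rightarrow> real \<Rightarrow> real" where
  "beta_minus m W = (real m + W - sqrt ((real m + W)\<^sup>2 - 4 * W)) / 2"

definition S_coeff :: "nat \<Rightarrow> nat \<Rightarrow> (nat \<Rightarrow> real) \<Rightarrow> (nat \<Rightarrow> real) \<Rightarrow> real" where
  "S_coeff n m w \<delta> =
     (let W = (\<Sum>i<n. w i); \<Delta> = (\<Sum>i<m. \<delta> i); a = alpha n 2 in
        \<Delta> - (\<Delta> - \<delta> 0 * a) / (a\<^sup>2 - (real m + W) * a + W)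
              * (\<Sum>i<n. w i * cos (2 * real i * pi / real n)))"

lemma mset_proots_choice:
  "mset (SOME es. mset es = proots (p :: complex poly)) = proots p"
  by (rule someI_ex) (rule ex_mset)

lemma Re_lambda2:
  assumes "A \<in> carrier_mat k k" "k \<ge> 2"
    and "mset es = proots (char_poly (complex_mat A))"
  shows "Re (lambda2 A) = sort (map Re es) ! 1"
proof -
  let ?p = "char_poly (complex_mat A)"
  define fs where "fs = (SOME es. mset es = proots ?p)"
  have fs: "mset fs = proots ?p" unfolding fs_def by (rule mset_proots_choice)
  have cm: "complex_mat A \<in> carrier_mat k k" using assms(1) by simp
  have "size (proots ?p) = degree ?p"
    by (rule size_proots_complex)
  hence len: "length fs = k"
    using degree_monic_char_poly[OF cm] fs by (metis size_mset)
  have "sort (map Re es) = map Re (sort_key Re fs)"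
    by (rule properties_for_sort) (use fs assms(3) in auto)
  thus ?thesis
    using len assms(2) by (simp add: lambda2_def fs_def[symmetric])
qed

(* The block forms of the two Laplacians. *)

lemma laplacian_cycle:
  assumes "n \<ge> 3"
  shows "laplacian (cycle_adj n) =
    mat n n (\<lambda>(i, j). if i = j then 2
                      else if j = Suc i mod n \<or> i = Suc j mod n then - 1 else 0)"
proof -
  have nb: "{j. j < n \<and> (j = Suc i mod n \<or> i = Suc j mod n)} =
      {Suc i mod n, if i = 0 then n - 1 else i - 1}" if "i < n" for i
    using that assms by (auto simp: mod_Suc split: if_splits)
  have deg: "(\<Sum>j<n. if j = Suc i mod n \<or> i = Suc j mod n then 1 else 0) = (2::real)"
    if i: "i < n" for i
  proof -
    have ne: "Suc i mod n \<noteq> (if i = 0 then n - 1 else i - 1)"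
      using i assms by (auto simp: mod_Suc)
    have "(\<Sum>j<n. if j = Suc i mod n \<or> i = Suc j mod n then 1 else 0) =
        real (card {j. j < n \<and> (j = Suc i mod n \<or> i = Suc j mod n)})"
      by (subst sum.inter_filter[symmetric]) simp_all
    also have "\<dots> = 2" unfolding nb[OF i] using ne by simp
    finally show ?thesis .
  qed
  have no_loop: "i \<noteq> Suc i mod n" if "i < n" for i
    using that assms by (auto simp: mod_Suc)
  show ?thesis
    by (rule eq_matI)
      (use no_loop in \<open>auto simp: laplacian_def cycle_adj_def mat_diag_def deg\<close>)
qed

lemma laplacian_star:
  assumes "m \<ge> 1"
  shows "laplacian (star_adj m) =
    four_block_mat (mat 1 1 (\<lambda>_. real m - 1)) (mat 1 (m - 1) (\<lambda>_. - 1))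
                   (mat (m - 1) 1 (\<lambda>_. - 1)) (1\<^sub>m (m - 1))"
proof -
  have m: "{..<m} = insert 0 {1..<m}" using assms by auto
  have hub: "(\<Sum>j<m. if 0 < j then 1 else 0) = real m - 1"
    unfolding m using assms by simp
  show ?thesis
    by (rule eq_matI)
      (use assms in \<open>auto simp: laplacian_def star_adj_def mat_diag_def
         four_block_mat_def Let_def hub cong: if_cong\<close>)
qed

lemma sum_lessThan_add:
  "(\<Sum>j<n + m. f j) = (\<Sum>j<n. f j) + (\<Sum>j<m. f (n + j) :: real)" for n m :: nat
  by (induction m) auto

lemma L_Gp_block:
  "L_Gp n m w \<delta> =
     four_block_mat (laplacian (cycle_adj n) + corner_mat n (\<Sum>i<m. \<delta> i))
                    (- first_row_mat n m \<delta>)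
                    (- first_row_mat m n w)
                    (laplacian (star_adj m) + corner_mat m (\<Sum>i<n. w i))"
  by (rule eq_matI)
    (auto simp: L_Gp_def adj_Gp_def laplacian_def mat_diag_def first_row_mat_def
       corner_mat_def cycle_adj_def star_adj_def sum_lessThan_add)

lemma L_G_block:
  "L_G n m w =
     four_block_mat (laplacian (cycle_adj n)) (0\<^sub>m n m)
                    (- first_row_mat m n w)
                    (laplacian (star_adj m) + corner_mat m (\<Sum>i<n. w i))"
  by (rule eq_matI)
    (auto simp: L_G_def adj_G_def laplacian_def mat_diag_def first_row_mat_def
       corner_mat_def cycle_adj_def star_adj_def sum_lessThan_add)

end

theory Submission
  imports Defs
begin

text \<open>The modification only changes the first row of the Laplacian, so Cramer's rule turns the
  resolvent of the cycle (a finite Fourier sum, the cycle being diagonalised by the Hartley matrix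
  \<open>cos + sin\<close>) and the explicit spectrum of the star into the factorisation
  \<open>(x - 1)\<^bsup>m-2\<^esup> \<cdot> (\<Prod>n/2 < k < n. x - \<alpha>\<^sub>2\<^sub>k) \<cdot> B\<^sub>\<delta>(x)\<close> of the characteristic polynomial.
  Only \<open>B\<^sub>\<delta>\<close> (\<open>moving_poly\<close> below) depends on the modification, and the roots of \<open>B\<^sub>0\<close>,
  namely \<open>\<beta>\<^sup>-\<close>, the other root \<open>\<beta>\<^sup>+\<close> of \<open>x\<^sup>2 - (m + w) x + w\<close>, and the distinct
  \<open>\<alpha>\<^sub>2\<^sub>k\<close>, are simple. Hence for small \<open>\<delta>\<close> all roots of \<open>B\<^sub>\<delta>\<close> stay real and move little, and the
  sign of \<open>B\<^sub>\<delta>\<close> at \<open>\<alpha>\<^sub>2\<close> (the sign of \<open>S\<close>) or at \<open>\<beta>\<^sup>-\<close> (the sign of the cosine sum) decides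
  the direction. For arbitrary \<open>\<delta>\<close> the sign of \<open>B\<^sub>\<delta>\<close> just to the right of its root \<open>0\<close> is known,
  so the intermediate value theorem produces a root in \<open>(0, \<alpha>\<^sub>2)\<close>, respectively \<open>(0, \<beta>\<^sup>-)\<close>.\<close>

subsection \<open>Determinants and the Laplacian of the cycle\<close>

text \<open>Cramer's rule without division: \<open>adj_mat A * A\<close> is \<open>det A\<close>
  times the identity. Applied to \<open>z\<close>, which \<open>A\<close> sends to the first unit
  vector, only the cofactors of row 0 survive.\<close>

lemma cofactor_first_row:
  fixes A :: "'a :: comm_ring_1 mat"
  assumes A: "A \<in> carrier_mat N N" and j: "j < N"
    and z: "\<And>i. i < N \<Longrightarrow> (\<Sum>j<N. A $$ (i, j) * z j) = (if i = 0 then 1 else 0)"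
  shows "cofactor A 0 j = det A * z j"
proof -
  have N: "0 < N" using j by simp
  \<comment> \<open>This double sum is entry \<open>j\<close> of the adjugate times \<open>A\<close>
    times \<open>z\<close>; it is evaluated in both bracketings.\<close>
  have "(\<Sum>l<N. (\<Sum>i<N. cofactor A i j * A $$ (i, l)) * z l)
      = (\<Sum>l<N. (if j = l then det A else 0) * z l)"
  proof (rule sum.cong[OF refl])
    fix l assume "l \<in> {..<N}"
    hence l: "l < N" by simp
    have "(adj_mat A * A) $$ (j, l) = (det A \<cdot>\<^sub>m 1\<^sub>m N) $$ (j, l)"
      by (simp only: adj_mat(3)[OF A])
    moreover have "(adj_mat A * A) $$ (j, l) = (\<Sum>i<N. cofactor A i j * A $$ (i, l))"
      unfolding times_mat_def scalar_prod_def adj_mat_def using j l A by (auto intro: sum.cong)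
    ultimately have "(\<Sum>i<N. cofactor A i j * A $$ (i, l)) = (if j = l then det A else 0)"
      using j l by simp
    thus "(\<Sum>i<N. cofactor A i j * A $$ (i, l)) * z l = (if j = l then det A else 0) * z l"
      by simp
  qed
  also have "\<dots> = (\<Sum>l<N. if j = l then det A * z l else 0)"
    by (rule sum.cong) auto
  also have "\<dots> = det A * z j" using j by simp
  finally have "(\<Sum>l<N. (\<Sum>i<N. cofactor A i j * A $$ (i, l)) * z l) = det A * z j" .
  moreover have "(\<Sum>l<N. (\<Sum>i<N. cofactor A i j * A $$ (i, l)) * z l)
      = (\<Sum>i<N. cofactor A i j * (\<Sum>l<N. A $$ (i, l) * z l))"
    by (simp add: sum_distrib_left sum_distrib_right mult.assoc) (rule sum.swap)
  moreover have "\<dots> = (\<Sum>i<N. if i = 0 then cofactor A i j else 0)"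
    by (rule sum.cong) (use z in auto)
  moreover have "\<dots> = cofactor A 0 j" using N by simp
  ultimately show ?thesis by simp
qed

text \<open>Cofactors along row 0 do not see row 0, so \<open>A\<close> and \<open>B\<close> share
  them. Expanding \<open>det B\<close> along row 0 therefore only requires solving one system with
  the simpler matrix \<open>A\<close>.\<close>

lemma det_change_first_row:
  fixes A B :: "'a :: comm_ring_1 mat"
  assumes A: "A \<in> carrier_mat N N" and B: "B \<in> carrier_mat N N" and N: "0 < N"
    and rows: "\<And>i j. 0 < i \<Longrightarrow> i < N \<Longrightarrow> j < N \<Longrightarrow> A $$ (i, j) = B $$ (i, j)"
    and z: "\<And>i. i < N \<Longrightarrow> (\<Sum>j<N. A $$ (i, j) * z j) = (if i = 0 then 1 else 0)"
  shows "det B = det A * (\<Sum>j<N. B $$ (0, j) * z j)"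
proof -
  have "mat_delete B 0 j = mat_delete A 0 j" for j
    by (rule eq_matI) (use A B rows in \<open>auto simp: mat_delete_def\<close>)
  hence "cofactor B 0 j = cofactor A 0 j" for j by (simp add: cofactor_def)
  hence "det B = (\<Sum>j<N. B $$ (0, j) * (det A * z j))"
    unfolding laplace_expansion_row[OF B N] by (intro sum.cong) (auto simp: cofactor_first_row[OF A _ z])
  thus ?thesis by (simp add: sum_distrib_left ac_simps)
qed

lemma poly_char_poly_det:
  fixes A :: "'a :: field mat"
  assumes "A \<in> carrier_mat N N"
  shows "poly (char_poly A) x = det (x \<cdot>\<^sub>m 1\<^sub>m N - A)"
proof -
  have "- char_matrix A x = x \<cdot>\<^sub>m 1\<^sub>m N - A"
    by (rule eq_matI) (use assms in \<open>auto simp: char_matrix_def\<close>)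
  thus ?thesis using char_poly_matrix[OF assms] by simp
qed

lemma char_poly_four_block_lower:
  fixes A :: "real mat"
  assumes "A \<in> carrier_mat n n" "C \<in> carrier_mat m n" "D \<in> carrier_mat m m"
  shows "poly (char_poly (four_block_mat A (0\<^sub>m n m) C D)) x =
    poly (char_poly A) x * poly (char_poly D) x"
proof -
  have "four_block_mat A (0\<^sub>m n m) C D \<in> carrier_mat (n + m) (n + m)"
    using assms by auto
  note e = poly_char_poly_det[OF this]
  have "x \<cdot>\<^sub>m 1\<^sub>m (n + m) - four_block_mat A (0\<^sub>m n m) C D =
      four_block_mat (x \<cdot>\<^sub>m 1\<^sub>m n - A) (0\<^sub>m n m) (- C) (x \<cdot>\<^sub>m 1\<^sub>m m - D)"
    by (rule eq_matI) (use assms in auto)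
  thus ?thesis unfolding e
    by (simp add: poly_char_poly_det[OF assms(1)] poly_char_poly_det[OF assms(3)])
       (rule det_four_block_mat_upper_right_zero, use assms in auto)
qed

section \<open>Fourier modes and spectrum of the cycle Laplacian\<close>

lemma sum_row_laplacian_cycle:
  assumes "n \<ge> 3" "i < n"
  shows "(\<Sum>j<n. laplacian (cycle_adj n) $$ (i, j) * f j) =
    2 * f i - f (Suc i mod n) - f (if i = 0 then n - 1 else i - 1)"
proof -
  obtain p s where p: "p = (if i = 0 then n - 1 else i - 1)" and s: "s = Suc i mod n" by blast
  have d: "i \<noteq> s" "i \<noteq> p" "s \<noteq> p" "s < n" "p < n"
    using assms by (auto simp: mod_Suc p s)
  have *: "i = Suc j mod n \<longleftrightarrow> j = p" if "j < n" for j
    using that assms by (auto simp: mod_Suc p)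
  have "(\<Sum>j<n. laplacian (cycle_adj n) $$ (i, j) * f j) =
    (\<Sum>j<n. (if j = i then 2 * f j else 0) - (if j = s then f j else 0)
       - (if j = p then f j else 0))"
    by (rule sum.cong[OF refl])
       (use assms d in \<open>auto simp: laplacian_cycle[OF assms(1)] * s[symmetric]\<close>)
  also have "\<dots> = 2 * f i - f s - f p"
    unfolding sum_subtractf using d assms by simp
  finally show ?thesis by (simp only: p s)
qed

text \<open>Reading a vector on the cycle as an \<open>n\<close>-periodic function on the integers
  absorbs the wrap-around at both ends.\<close>

lemma sum_row_laplacian_cycle_periodic:
  fixes F :: "int \<Rightarrow> real"
  assumes "n \<ge> 3" "i < n" and per: "\<And>x. F (x + int n) = F x"
  shows "(\<Sum>j<n. laplacian (cycle_adj n) $$ (i, j) * F (int j)) =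
    2 * F (int i) - F (int i + 1) - F (int i - 1)"
proof -
  have "F (int (Suc i mod n)) = F (int i + 1)"
    using per[of 0] assms by (auto simp: mod_Suc add.commute)
  moreover have "F (int (if i = 0 then n - 1 else i - 1)) = F (int i - 1)"
    using per[of "-1"] assms by (auto simp: of_nat_diff)
  ultimately show ?thesis by (simp add: sum_row_laplacian_cycle[OF assms(1,2)])
qed

lemma alpha_even: "alpha n (2 * k) = 2 * (1 - cos (2 * pi * real k / real n))"
  by (simp add: alpha_def mult_ac)

text \<open>With step angle \<open>t = 2 * pi * k / n\<close>, the two neighbours of a node add up
  to \<open>2 * cos t\<close> times its value, by the addition theorems; the eigenvalue is thus
  \<open>2 - 2 * cos t\<close>.\<close>

lemma sum_row_laplacian_cycle_eigen:
  assumes "n \<ge> 3" "i < n"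
  shows "(\<Sum>j<n. laplacian (cycle_adj n) $$ (i, j) * cos (2 * pi * real k * real j / real n)) =
    alpha n (2 * k) * cos (2 * pi * real k * real i / real n)"
    and "(\<Sum>j<n. laplacian (cycle_adj n) $$ (i, j) * sin (2 * pi * real k * real j / real n)) =
    alpha n (2 * k) * sin (2 * pi * real k * real i / real n)"
proof -
  define t where "t = 2 * pi * real k / real n"
  have n: "real n \<noteq> 0" using assms by simp
  have tn: "t * real n = 2 * pi * real k" using n by (simp add: t_def)
  have *: "2 * pi * real k * real j / real n = t * real_of_int (int j)" for j
    by (simp add: t_def)
  have a: "alpha n (2 * k) = 2 * (1 - cos t)" by (simp only: alpha_even t_def)
  have per: "t * real_of_int (x + int n) = t * real_of_int x + 2 * pi * real k" for x
    using tn by (simp add: algebra_simps)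
  have c: "cos (t * real_of_int (x + int n)) = cos (t * real_of_int x)"
   and s: "sin (t * real_of_int (x + int n)) = sin (t * real_of_int x)" for x
    unfolding per cos_add sin_add using cos_int_2pin[of "int k"] sin_int_2pin[of "int k"]
    by (simp_all only: of_int_of_nat_eq mult_1_right mult_zero_right diff_zero add_0_right)
  show "(\<Sum>j<n. laplacian (cycle_adj n) $$ (i, j) * cos (2 * pi * real k * real j / real n)) =
    alpha n (2 * k) * cos (2 * pi * real k * real i / real n)"
    unfolding * sum_row_laplacian_cycle_periodic[OF assms, of "\<lambda>x. cos (t * real_of_int x)", OF c]
    by (simp only: a of_int_add of_int_diff of_int_1 distrib_left right_diff_distrib mult_1_right)
       (simp add: algebra_simps cos_add cos_diff)
  show "(\<Sum>j<n. laplacian (cycle_adj n) $$ (i, j) * sin (2 * pi * real k * real j / real n)) =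
    alpha n (2 * k) * sin (2 * pi * real k * real i / real n)"
    unfolding * sum_row_laplacian_cycle_periodic[OF assms, of "\<lambda>x. sin (t * real_of_int x)", OF s]
    by (simp only: a of_int_add of_int_diff of_int_1 distrib_left right_diff_distrib mult_1_right)
       (simp add: algebra_simps sin_add sin_diff)
qed

text \<open>Real and imaginary parts of a geometric sum over the powers of an \<open>n\<close>-th
  root of unity, which equals 1 exactly when \<open>n\<close> divides \<open>l\<close>.\<close>

lemma sum_roots_of_unity:
  fixes l :: int
  assumes "n > 0" 
  shows "(\<Sum>k<n. cos (2 * pi * real k * real_of_int l / real n)) = (if int n dvd l then real n else 0)"
    and "(\<Sum>k<n. sin (2 * pi * real k * real_of_int l / real n)) = 0"
proof -
  define z where "z = cis (2 * pi * real_of_int l / real n)"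
  have zk: "z ^ k = cis (2 * pi * real k * real_of_int l / real n)" for k
    unfolding z_def DeMoivre by (simp add: mult_ac)
  have "2 * pi * real n * real_of_int l / real n = 2 * pi * real_of_int l" using assms by simp
  hence zn: "z ^ n = 1"
    by (simp only: zk complex_eq_iff cis.sel sin_int_2pin cos_int_2pin one_complex.sel)
  have z1: "z = 1 \<longleftrightarrow> int n dvd l"
  proof
    assume "z = 1"
    hence "cos (2 * pi * real_of_int l / real n) = 1" by (simp add: z_def complex_eq_iff)
    then obtain x :: int where "2 * pi * real_of_int l / real n = real_of_int x * 2 * pi"
      using cos_one_2pi_int by metis
    hence "real_of_int l = real_of_int (x * int n)" using assms by (simp add: field_simps)
    hence "l = x * int n" by (simp only: of_int_eq_iff)
    thus "int n dvd l" by simp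
  next
    assume "int n dvd l"
    then obtain x where "l = int n * x" ..
    hence "2 * pi * real_of_int l / real n = 2 * pi * real_of_int x" using assms by simp
    hence "z = cis (2 * pi * real_of_int x)" by (simp only: z_def)
    moreover have "cis (2 * pi * real_of_int x) = 1"
      by (simp only: complex_eq_iff cis.sel sin_int_2pin cos_int_2pin one_complex.sel)
    ultimately show "z = 1" by (rule trans)
  qed
  have "(\<Sum>k<n. z ^ k) = (if int n dvd l then of_nat n else 0)"
    using zn z1 by (auto simp: geometric_sum)
  hence "Re (\<Sum>k<n. z ^ k) = (if int n dvd l then real n else 0)" "Im (\<Sum>k<n. z ^ k) = 0"
    by auto
  thus "(\<Sum>k<n. cos (2 * pi * real k * real_of_int l / real n)) = (if int n dvd l then real n else 0)"
    "(\<Sum>k<n. sin (2 * pi * real k * real_of_int l / real n)) = 0"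
    by (simp_all add: zk)
qed

text \<open>The Hartley matrix \<open>H\<close> is real and satisfies \<open>H * H = n I\<close>, so
  it diagonalises the Laplacian over the reals with all \<open>n\<close> eigenvalues at once,
  repeated ones included.\<close>

lemma char_poly_cycle:
  assumes n: "n \<ge> 3"
  shows "poly (char_poly (laplacian (cycle_adj n))) x = (\<Prod>k<n. x - alpha n (2 * k))"
proof -
  define cas where "cas i k = cos (2 * pi * real k * real i / real n) + sin (2 * pi * real k * real i / real n)"
    for i k :: nat
  define H where "H = mat n n (\<lambda>(i, k). cas i k)"
  define E where "E = mat n n (\<lambda>(i, j). if i = j then x - alpha n (2 * i) else 0)"
  let ?L = "laplacian (cycle_adj n)"
  have L: "?L \<in> carrier_mat n n" by (simp add: laplacian_cycle[OF n])
  have H: "H \<in> carrier_mat n n" and E: "E \<in> carrier_mat n n" by (auto simp: H_def E_def)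
  have HH: "H * H = real n \<cdot>\<^sub>m 1\<^sub>m n"
  proof (rule eq_matI)
    fix i j assume "i < dim_row (real n \<cdot>\<^sub>m 1\<^sub>m n)" "j < dim_col (real n \<cdot>\<^sub>m 1\<^sub>m n)"
    hence ij: "i < n" "j < n" by auto
    \<comment> \<open>The product splits into a cosine of the difference and a sine of the sum;
      summed over \<open>k\<close>, the sines vanish and the cosines detect
      \<open>i = j\<close>.\<close>
    have cas2: "cas i k * cas k j = cos (2 * pi * real k * real_of_int (int i - int j) / real n) +
        sin (2 * pi * real k * real_of_int (int i + int j) / real n)" for k
    proof -
      have e: "2 * pi * real k * real_of_int (int i - int j) / real n =
          2 * pi * real k * real i / real n - 2 * pi * real j * real k / real n"
        "2 * pi * real k * real_of_int (int i + int j) / real n =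
          2 * pi * real k * real i / real n + 2 * pi * real j * real k / real n"
        by (simp_all add: algebra_simps add_divide_distrib diff_divide_distrib)
      show ?thesis unfolding e cas_def cos_diff sin_add by (simp add: algebra_simps)
    qed
    have dv: "int n dvd int i - int j \<longleftrightarrow> i = j"
    proof
      assume "int n dvd int i - int j"
      moreover have "\<bar>int i - int j\<bar> < int n" using ij by auto
      ultimately show "i = j" using dvd_imp_le_int[of "int i - int j" "int n"] by force
    qed auto
    have "(H * H) $$ (i, j) = (\<Sum>k<n. cas i k * cas k j)"
      using ij by (auto simp: H_def times_mat_def scalar_prod_def intro!: sum.cong)
    also have "\<dots> = (if i = j then real n else 0)"
    proof -
      have "n > 0" using n by simp
      thus ?thesis unfolding cas2 sum.distrib
        by (simp only: sum_roots_of_unity dv add_0_right)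
    qed
    finally show "(H * H) $$ (i, j) = (real n \<cdot>\<^sub>m 1\<^sub>m n) $$ (i, j)" using ij by simp
  qed (use H in auto)
  have "(x \<cdot>\<^sub>m 1\<^sub>m n - ?L) * H = H * E"
  proof (rule eq_matI)
    fix i k assume "i < dim_row (H * E)" "k < dim_col (H * E)"
    hence ik: "i < n" "k < n" using H E by auto
    have "(H * E) $$ (i, k) = (\<Sum>j<n. cas i j * (if j = k then x - alpha n (2 * j) else 0))"
      using ik by (auto simp: H_def E_def times_mat_def scalar_prod_def intro!: sum.cong)
    also have "\<dots> = (\<Sum>j<n. if j = k then cas i j * (x - alpha n (2 * j)) else 0)"
      by (rule sum.cong) auto
    also have "\<dots> = (x - alpha n (2 * k)) * cas i k" using ik by simp
    finally have 1: "(H * E) $$ (i, k) = (x - alpha n (2 * k)) * cas i k" .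
    have "((x \<cdot>\<^sub>m 1\<^sub>m n - ?L) * H) $$ (i, k) =
        (\<Sum>j<n. ((if i = j then x else 0) - ?L $$ (i, j)) * cas j k)"
      using ik L by (auto simp: H_def times_mat_def scalar_prod_def intro!: sum.cong)
    also have "\<dots> = (\<Sum>j<n. (if i = j then x * cas j k else 0) - ?L $$ (i, j) * cas j k)"
      by (rule sum.cong) (auto simp: algebra_simps)
    also have "\<dots> = x * cas i k - (\<Sum>j<n. ?L $$ (i, j) * cas j k)"
      using ik by (simp add: sum_subtractf)
    also have "(\<Sum>j<n. ?L $$ (i, j) * cas j k) = alpha n (2 * k) * cas i k"
      unfolding cas_def distrib_left sum.distrib sum_row_laplacian_cycle_eigen[OF n ik(1)] ..
    finally show "((x \<cdot>\<^sub>m 1\<^sub>m n - ?L) * H) $$ (i, k) = (H * E) $$ (i, k)"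
      unfolding 1 by (simp add: algebra_simps)
  qed (use L H E in auto)
  hence "det ((x \<cdot>\<^sub>m 1\<^sub>m n - ?L) * H) = det (H * E)" by simp
  moreover have "det ((x \<cdot>\<^sub>m 1\<^sub>m n - ?L) * H) = det (x \<cdot>\<^sub>m 1\<^sub>m n - ?L) * det H"
    by (rule det_mult[of _ n]) (use L H in auto)
  moreover have "det (H * E) = det H * det E" by (rule det_mult[of _ n]) (use H E in auto)
  moreover have "det H \<noteq> 0"
  proof
    assume "det H = 0"
    hence "det (H * H) = 0" by (simp add: det_mult[OF H H])
    thus False using n by (simp add: HH det_smult)
  qed
  ultimately have "det (x \<cdot>\<^sub>m 1\<^sub>m n - ?L) = det E" by simp
  also have "det E = prod_list (diag_mat E)"
    by (rule det_upper_triangular[OF _ E]) (auto simp: E_def)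
  also have "\<dots> = (\<Prod>k<n. x - alpha n (2 * k))"
    unfolding prod_list_diag_prod by (auto simp: E_def lessThan_atLeast0 intro!: prod.cong)
  finally show ?thesis by (simp add: poly_char_poly_det[OF L])
qed

section \<open>The star Laplacian with extra weight at the hub\<close>

lemma sum_lessThan_remove_zero:
  fixes f :: "nat \<Rightarrow> 'a :: comm_monoid_add"
  shows "0 < m \<Longrightarrow> (\<Sum>j<m. f j) = f 0 + (\<Sum>j=1..<m. f j)"
  using sum.atLeast_Suc_lessThan[of 0 m f] by (simp add: lessThan_atLeast0)

lemma laplacian_star_entry:
  assumes "i < m" "j < m"
  shows "laplacian (star_adj m) $$ (i, j) =
    (if i = 0 \<and> j = 0 then real m - 1 else if i = j then 1 else if i = 0 \<or> j = 0 then - 1 else 0)"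
  using assms by (subst laplacian_star) auto

text \<open>Lets determinant formulas with denominators be proved away from their poles and then
  read as polynomial identities.\<close>

lemma poly_eqI_cofinite:
  fixes p r :: "'a :: {idom, ring_char_0} poly"
  assumes "finite S" "\<And>x. x \<notin> S \<Longrightarrow> poly p x = poly r x"
  shows "p = r"
proof (rule ccontr)
  assume "p \<noteq> r"
  hence "finite {x. poly (p - r) x = 0}" by (intro poly_roots_finite) simp
  moreover have "- S \<subseteq> {x. poly (p - r) x = 0}" using assms(2) by auto
  ultimately have "finite (- S)" by (rule rev_finite_subset)
  thus False using assms(1) infinite_UNIV_char_0[where 'a = 'a] by (metis finite_compl)
qed

text \<open>Replacing the hub row of \<open>x I - L\<close> by the first unit vector leaves a lower
  triangular matrix \<open>A\<close> with determinant \<open>(x - 1) ^ (m - 1)\<close>. The solution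
  \<open>z\<close> of \<open>A z = e_0\<close> is explicit for \<open>x \<noteq> 1\<close>, and the
  row change supplies the quadratic divided by \<open>x - 1\<close>.\<close>

lemma char_poly_star_corner:
  assumes m: "m \<ge> 2"
  shows "poly (char_poly (laplacian (star_adj m) + corner_mat m W)) x =
    (x - 1) ^ (m - 2) * (x\<^sup>2 - (real m + W) * x + W)"
proof -
  let ?L = "laplacian (star_adj m) + corner_mat m W"
  have L: "?L \<in> carrier_mat m m" by (auto simp: laplacian_def corner_mat_def star_adj_def)
  have *: "poly (char_poly ?L) x = (x - 1) ^ (m - 2) * (x\<^sup>2 - (real m + W) * x + W)" if x: "x \<noteq> 1" for x
  proof -
    define A where "A = mat m m (\<lambda>(i, j). if i = 0 \<and> j = 0 then 1 else if i = j then x - 1 else if j = 0 then 1 else 0)"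
    have A: "A \<in> carrier_mat m m" by (simp add: A_def)
    define z where "z j = (if j = 0 then 1 else - 1 / (x - 1))" for j :: nat
    have entry: "(x \<cdot>\<^sub>m 1\<^sub>m m - ?L) $$ (i, j) =
        (if i = 0 \<and> j = 0 then x - (real m - 1) - W else if i = j then x - 1
         else if i = 0 \<or> j = 0 then 1 else 0)" if "i < m" "j < m" for i j
      using that L by (auto simp: laplacian_star_entry corner_mat_def)
    have "det (x \<cdot>\<^sub>m 1\<^sub>m m - ?L) = det A * (\<Sum>j<m. (x \<cdot>\<^sub>m 1\<^sub>m m - ?L) $$ (0, j) * z j)"
    proof (rule det_change_first_row[OF A])
      fix i assume i: "i < m"
      show "(\<Sum>j<m. A $$ (i, j) * z j) = (if i = 0 then 1 else 0)"
      proof (cases "i = 0")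
        case True
        have "(\<Sum>j<m. A $$ (i, j) * z j) = (\<Sum>j<m. if j = 0 then 1 else 0)"
          by (rule sum.cong) (use True i in \<open>auto simp: A_def z_def\<close>)
        thus ?thesis using True m by simp
      next
        case False
        have "(\<Sum>j<m. A $$ (i, j) * z j) = (\<Sum>j<m. (if j = 0 then 1 else 0) + (if j = i then (x - 1) * z j else 0))"
          by (rule sum.cong) (use False i in \<open>auto simp: A_def z_def\<close>)
        also have "\<dots> = 0" using False i x unfolding sum.distrib by (simp add: z_def)
        finally show ?thesis using False by simp
      qed
    next
      show "x \<cdot>\<^sub>m 1\<^sub>m m - ?L \<in> carrier_mat m m" by (rule minus_carrier_mat[OF L])
    next
      fix i j assume "0 < i" "i < m" "j < m"
      thus "A $$ (i, j) = (x \<cdot>\<^sub>m 1\<^sub>m m - ?L) $$ (i, j)"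
        by (simp only: entry) (simp add: A_def)
    qed (use m in auto)
    also have "(\<Sum>j<m. (x \<cdot>\<^sub>m 1\<^sub>m m - ?L) $$ (0, j) * z j) =
        (x - (real m - 1) - W) + (\<Sum>j=1..<m. - 1 / (x - 1))"
      using m by (subst sum_lessThan_remove_zero) (auto simp: entry z_def intro!: sum.cong)
    also have "\<dots> = (x - (real m - 1) - W) - (real m - 1) / (x - 1)"
      using m by (simp add: of_nat_diff)
    also have "\<dots> = (x\<^sup>2 - (real m + W) * x + W) / (x - 1)"
      using x by (simp add: field_simps power2_eq_square)
    also have "det A = (x - 1) ^ (m - 1)"
    proof -
      have "det A = prod_list (diag_mat A)"
        by (rule det_lower_triangular[OF _ A]) (auto simp: A_def)
      also have "\<dots> = (\<Prod>i<m. if i = 0 then 1 else x - 1)"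
        unfolding prod_list_diag_prod by (auto simp: A_def lessThan_atLeast0 intro!: prod.cong)
      also have "\<dots> = (\<Prod>i=1..<m. if i = 0 then 1 else x - 1)"
        using m prod.atLeast_Suc_lessThan[of 0 m "\<lambda>i. if i = 0 then 1 else x - 1"]
        by (simp add: lessThan_atLeast0)
      also have "\<dots> = (\<Prod>i=1..<m. x - 1)" by (rule prod.cong) auto
      finally show ?thesis by simp
    qed
    also have "(x - 1) ^ (m - 1) = (x - 1) ^ (m - 2) * (x - 1)"
      using m by (simp flip: power_Suc2 add: Suc_diff_le numeral_2_eq_2 Suc_diff_Suc)
    finally show ?thesis using x by (simp add: poly_char_poly_det[OF L])
  qed
  have "char_poly ?L = [:-1, 1:] ^ (m - 2) * [:W, - (real m + W), 1:]"
    by (rule poly_eqI_cofinite[of "{1}"])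
       (auto simp: * poly_power power2_eq_square algebra_simps)
  thus ?thesis by (simp add: poly_power power2_eq_square algebra_simps)
qed

subsection \<open>Resolvents and the characteristic polynomial\<close>

text \<open>The first column of the inverse of \<open>x I - L\<close> for the cycle Laplacian
  \<open>L\<close>, in its Fourier expansion.\<close>

definition cycle_resolvent :: "nat \<Rightarrow> real \<Rightarrow> nat \<Rightarrow> real" where
  "cycle_resolvent n x i =
     (\<Sum>k<n. cos (2 * pi * real k * real i / real n) / (x - alpha n (2 * k))) / real n"

text \<open>On mode \<open>k\<close> the operator multiplies by \<open>x - alpha n (2 * k)\<close>
  and cancels the denominator; the bare cosines then sum to a unit vector.\<close>

lemma cycle_resolvent:
  assumes n: "n \<ge> 3" and i: "i < n" and x: "\<And>k. k < n \<Longrightarrow> x \<noteq> alpha n (2 * k)"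
  shows "x * cycle_resolvent n x i - (\<Sum>j<n. laplacian (cycle_adj n) $$ (i, j) * cycle_resolvent n x j)
    = (if i = 0 then 1 else 0)"
proof -
  let ?c = "\<lambda>k i. cos (2 * pi * real k * real i / real n)"
  have "(\<Sum>j<n. laplacian (cycle_adj n) $$ (i, j) * cycle_resolvent n x j) =
      (\<Sum>k<n. (\<Sum>j<n. laplacian (cycle_adj n) $$ (i, j) * ?c k j) / (x - alpha n (2 * k))) / real n"
    unfolding cycle_resolvent_def sum_divide_distrib sum_distrib_left
    by (subst sum.swap) (simp add: sum_distrib_left field_simps)
  also have "\<dots> = (\<Sum>k<n. alpha n (2 * k) * ?c k i / (x - alpha n (2 * k))) / real n"
    by (simp only: sum_row_laplacian_cycle_eigen[OF n i])
  finally have "x * cycle_resolvent n x i - (\<Sum>j<n. laplacian (cycle_adj n) $$ (i, j) * cycle_resolvent n x j)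
      = (\<Sum>k<n. x * ?c k i / (x - alpha n (2 * k)) - alpha n (2 * k) * ?c k i / (x - alpha n (2 * k))) / real n"
    by (simp add: cycle_resolvent_def sum_distrib_left sum_subtractf diff_divide_distrib)
  also have "\<dots> = (\<Sum>k<n. ?c k i) / real n"
    by (intro arg_cong2[of _ _ _ _ "(/)"] sum.cong refl)
       (use x in \<open>auto simp: diff_divide_distrib[symmetric] left_diff_distrib[symmetric]\<close>)
  also have "(\<Sum>k<n. ?c k i) = (if i = 0 then real n else 0)"
    using sum_roots_of_unity(1)[of n "int i"] n i by (auto simp: zdvd_not_zless)
  finally show ?thesis using n by auto
qed

section \<open>The rows and the characteristic polynomial of the modified Laplacian\<close>

lemma L_Gp_carrier: "L_Gp n m w \<delta> \<in> carrier_mat (n + m) (n + m)"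
  by (auto simp: L_Gp_def laplacian_def adj_Gp_def cycle_adj_def star_adj_def)

text \<open>Makes the unmodified graph the case \<delta> = 0, so that statements about
  \<open>L_Gp\<close> also serve \<open>L_G\<close>.\<close>

lemma L_Gp_zero: "L_Gp n m w (\<lambda>_. 0) = L_G n m w"
  unfolding L_Gp_block L_G_block
  by (rule eq_matI)
     (auto simp: laplacian_def cycle_adj_def star_adj_def first_row_mat_def corner_mat_def)

lemma sum_row_L_Gp_cycle:
  assumes "i < n"
  shows "(\<Sum>j<n + m. L_Gp n m w \<delta> $$ (i, j) * z j) =
    (\<Sum>j<n. laplacian (cycle_adj n) $$ (i, j) * z j) +
    (if i = 0 then (\<Sum>j<m. \<delta> j) * z 0 - (\<Sum>j<m. \<delta> j * z (n + j)) else 0)"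
proof -
  let ?L = "laplacian (cycle_adj n)"
  have "(\<Sum>j<n. L_Gp n m w \<delta> $$ (i, j) * z j) =
      (\<Sum>j<n. ?L $$ (i, j) * z j + (if j = 0 then if i = 0 then (\<Sum>j<m. \<delta> j) * z 0 else 0 else 0))"
    by (rule sum.cong)
       (use assms in \<open>auto simp: L_Gp_block laplacian_def cycle_adj_def star_adj_def corner_mat_def
          first_row_mat_def algebra_simps\<close>)
  also have "\<dots> = (\<Sum>j<n. ?L $$ (i, j) * z j) + (if i = 0 then (\<Sum>j<m. \<delta> j) * z 0 else 0)"
    unfolding sum.distrib using assms by simp
  finally have 1: "(\<Sum>j<n. L_Gp n m w \<delta> $$ (i, j) * z j) = \<dots>" .
  have "(\<Sum>j<m. L_Gp n m w \<delta> $$ (i, n + j) * z (n + j)) =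
      (\<Sum>j<m. - (if i = 0 then \<delta> j * z (n + j) else 0))"
    by (rule sum.cong)
       (use assms in \<open>auto simp: L_Gp_block laplacian_def cycle_adj_def star_adj_def corner_mat_def
          first_row_mat_def algebra_simps\<close>)
  thus ?thesis unfolding sum_lessThan_add 1 by (auto simp: sum_negf)
qed

lemma sum_row_L_Gp_star:
  assumes "i < m"
  shows "(\<Sum>j<n + m. L_Gp n m w \<delta> $$ (n + i, j) * z j) =
    (if i = 0 then (real m - 1 + (\<Sum>j<n. w j)) * z n - (\<Sum>j=1..<m. z (n + j)) - (\<Sum>j<n. w j * z j)
     else z (n + i) - z n)"
proof -
  have 1: "(\<Sum>j<n. L_Gp n m w \<delta> $$ (n + i, j) * z j) = (\<Sum>j<n. - (if i = 0 then w j * z j else 0))"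
    by (rule sum.cong)
       (use assms in \<open>auto simp: L_Gp_block laplacian_def cycle_adj_def star_adj_def corner_mat_def
          first_row_mat_def algebra_simps\<close>)
  have entry: "L_Gp n m w \<delta> $$ (n + i, n + j) = (if i = 0 \<and> j = 0 then real m - 1 + (\<Sum>j<n. w j)
      else if i = j then 1 else if i = 0 \<or> j = 0 then - 1 else 0)" if "j < m" for j
  proof -
    have "L_Gp n m w \<delta> $$ (n + i, n + j) = laplacian (star_adj m) $$ (i, j) + corner_mat m (\<Sum>j<n. w j) $$ (i, j)"
      using assms that by (auto simp: L_Gp_block laplacian_def cycle_adj_def star_adj_def corner_mat_def first_row_mat_def)
    thus ?thesis using assms that by (auto simp: laplacian_star_entry corner_mat_def)
  qed
  have 2: "(\<Sum>j<m. L_Gp n m w \<delta> $$ (n + i, n + j) * z (n + j)) =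
      L_Gp n m w \<delta> $$ (n + i, n + 0) * z (n + 0) +
      (\<Sum>j=1..<m. L_Gp n m w \<delta> $$ (n + i, n + j) * z (n + j))"
    by (rule sum_lessThan_remove_zero) (use assms in simp)
  show ?thesis
  proof (cases "i = 0")
    case True
    have "(\<Sum>j=1..<m. L_Gp n m w \<delta> $$ (n + i, n + j) * z (n + j)) = (\<Sum>j=1..<m. - z (n + j))"
      by (rule sum.cong) (use True entry in auto)
    moreover have "L_Gp n m w \<delta> $$ (n + i, n + 0) = real m - 1 + (\<Sum>j<n. w j)"
      using entry[of 0] True assms by simp
    ultimately show ?thesis unfolding sum_lessThan_add 1 2 using True
      by (simp only: sum_negf if_True add_0_right) (simp add: algebra_simps)
  next
    case False
    have "(\<Sum>j=1..<m. L_Gp n m w \<delta> $$ (n + i, n + j) * z (n + j)) = (\<Sum>j=1..<m. if j = i then z (n + i) else 0)"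
      by (rule sum.cong) (use False entry in auto)
    also have "\<dots> = z (n + i)" using False assms by simp
    finally show ?thesis unfolding sum_lessThan_add 1 2 using False assms entry[of 0]
      by (simp add: sum_negf algebra_simps)
  qed
qed

text \<open>The modification touches only row 0, so \<open>det_change_first_row\<close> compares it
  with the unmodified block triangular matrix; the last factor is the new row 0 applied to the
  solution \<open>z\<close> of the old system.\<close>

lemma char_poly_L_Gp_eq:
  fixes n m :: nat and w \<delta> :: "nat \<Rightarrow> real"
  defines "W \<equiv> (\<Sum>i<n. w i)" and "D \<equiv> (\<Sum>i<m. \<delta> i)"
  defines "q \<equiv> \<lambda>x. x\<^sup>2 - (real m + W) * x + W"
  assumes n: "n \<ge> 3" and m: "m \<ge> 2"
    and x: "\<And>k. k < n \<Longrightarrow> x \<noteq> alpha n (2 * k)" and qx: "q x \<noteq> 0"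
  shows "poly (char_poly (L_Gp n m w \<delta>)) x =
    (\<Prod>k<n. x - alpha n (2 * k)) * ((x - 1) ^ (m - 2) * q x) *
    (1 - D * cycle_resolvent n x 0 + (D - \<delta> 0 * x) * (\<Sum>i<n. w i * cycle_resolvent n x i) / q x)"
proof -
  define N where "N = n + m"
  define g where "g = cycle_resolvent n x"
  define s where "s = (\<Sum>i<n. w i * g i) / q x"
  \<comment> \<open>On the cycle \<open>z\<close> is the resolvent column. Leaf rows force equal
    leaf values \<open>s\<close> and hub value \<open>(1 - x) * s\<close>; the hub row then reads
    \<open>s * q x = (\<Sum>i<n. w i * g i)\<close>.\<close>
  define z where "z j = (if j < n then g j else if j = n then (1 - x) * s else s)" for j
  define M where "M \<delta> = x \<cdot>\<^sub>m 1\<^sub>m N - L_Gp n m w \<delta>" for \<delta>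
  have M: "M \<delta> \<in> carrier_mat N N" for \<delta> using L_Gp_carrier[of n m w \<delta>] by (auto simp: M_def N_def)
  have row: "(\<Sum>j<N. M \<delta> $$ (i, j) * z j) = x * z i - (\<Sum>j<N. L_Gp n m w \<delta> $$ (i, j) * z j)"
    if "i < N" for i \<delta>
  proof -
    have "(\<Sum>j<N. M \<delta> $$ (i, j) * z j) =
        (\<Sum>j<N. (if i = j then x * z j else 0) - L_Gp n m w \<delta> $$ (i, j) * z j)"
      by (rule sum.cong)
         (use that L_Gp_carrier[of n m w \<delta>] in \<open>auto simp: M_def N_def algebra_simps\<close>)
    thus ?thesis using that by (simp add: sum_subtractf)
  qed
  \<comment> \<open>Stated for every \<delta>: the zero modification yields the unit vector required
    by Cramer's rule, the given one yields the correction factor.\<close>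
  have Mz: "(\<Sum>j<N. M \<delta> $$ (i, j) * z j) =
      (if i = 0 then 1 - (\<Sum>j<m. \<delta> j) * g 0 + ((\<Sum>j<m. \<delta> j) - \<delta> 0 * x) * s else 0)"
    if i: "i < N" for i \<delta>
  proof (cases "i < n")
    case True
    have "(\<Sum>j<n. laplacian (cycle_adj n) $$ (i, j) * z j) = (\<Sum>j<n. laplacian (cycle_adj n) $$ (i, j) * g j)"
      by (rule sum.cong) (auto simp: z_def)
    moreover have "x * g i - (\<Sum>j<n. laplacian (cycle_adj n) $$ (i, j) * g j) = (if i = 0 then 1 else 0)"
      unfolding g_def by (rule cycle_resolvent[OF n True x])
    moreover have "(\<Sum>j<m. \<delta> j * z (n + j)) = ((\<Sum>j<m. \<delta> j) - \<delta> 0 * x) * s"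
      using m by (simp add: sum_lessThan_remove_zero z_def sum_distrib_right sum_distrib_left algebra_simps)
    ultimately show ?thesis
      using True unfolding row[OF i] unfolding N_def sum_row_L_Gp_cycle[OF True]
      by (auto simp: z_def)
  next
    case False
    then obtain j where j: "i = n + j" "j < m" using i by (metis N_def le_Suc_ex nat_add_left_cancel_less not_less)
    have ws: "(\<Sum>i<n. w i * z i) = s * q x"
      using qx by (auto simp: s_def z_def intro!: sum.cong)
    show ?thesis
    proof (cases "j = 0")
      case True
      have "(\<Sum>j=1..<m. z (n + j)) = (real m - 1) * s"
        using m by (simp add: z_def of_nat_diff)
      thus ?thesis using True j n unfolding row[OF i] unfolding N_def j(1) sum_row_L_Gp_star[OF j(2)] ws
        by (simp add: z_def W_def[symmetric] q_def power2_eq_square algebra_simps)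
    next
      case False
      thus ?thesis using j n unfolding row[OF i] unfolding N_def j(1) sum_row_L_Gp_star[OF j(2)]
        by (simp add: z_def algebra_simps)
    qed
  qed
  have "det (M \<delta>) = det (M (\<lambda>_. 0)) * (\<Sum>j<N. M \<delta> $$ (0, j) * z j)"
  proof (rule det_change_first_row[OF M M])
    show "0 < N" using n by (simp add: N_def)
    show "M (\<lambda>_. 0) $$ (i, j) = M \<delta> $$ (i, j)" if "0 < i" "i < N" "j < N" for i j
      using that by (auto simp: M_def N_def L_Gp_block laplacian_def cycle_adj_def star_adj_def
        corner_mat_def first_row_mat_def)
    show "(\<Sum>j<N. M (\<lambda>_. 0) $$ (i, j) * z j) = (if i = 0 then 1 else 0)" if "i < N" for i
      unfolding Mz[OF that] by simp
  qed
  moreover have "(\<Sum>j<N. M \<delta> $$ (0, j) * z j) = 1 - D * g 0 + (D - \<delta> 0 * x) * s"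
    using n by (subst Mz) (auto simp: N_def D_def)
  moreover have "det (M (\<lambda>_. 0)) = poly (char_poly (L_G n m w)) x"
    unfolding M_def L_Gp_zero[symmetric] N_def by (rule poly_char_poly_det[OF L_Gp_carrier, symmetric])
  moreover have "poly (char_poly (L_G n m w)) x = (\<Prod>k<n. x - alpha n (2 * k)) * ((x - 1) ^ (m - 2) * q x)"
  proof -
    have "laplacian (cycle_adj n) \<in> carrier_mat n n" "- first_row_mat m n w \<in> carrier_mat m n"
      "laplacian (star_adj m) + corner_mat m W \<in> carrier_mat m m"
      by (auto simp: laplacian_def cycle_adj_def star_adj_def first_row_mat_def corner_mat_def)
    from char_poly_four_block_lower[OF this] show ?thesis
      unfolding L_G_block W_def[symmetric] by (simp add: char_poly_cycle[OF n] char_poly_star_corner[OF m] q_def)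
  qed
  moreover have "det (M \<delta>) = poly (char_poly (L_Gp n m w \<delta>)) x"
    unfolding M_def N_def by (rule poly_char_poly_det[OF L_Gp_carrier, symmetric])
  ultimately show ?thesis by (simp add: g_def s_def)
qed

subsection \<open>The second eigenvalue and perturbation of simple roots\<close>

text \<open>If the second entry failed \<open>P\<close>, so would all later ones, leaving at most
  one entry with \<open>P\<close>. A downward closed \<open>P\<close> covers both strict and weak
  upper bounds.\<close>

lemma sort_second_downward:
  fixes xs :: "'a :: linorder list"
  assumes down: "\<And>x y. x \<le> y \<Longrightarrow> P y \<Longrightarrow> P x"
    and ab: "{#a, b#} \<subseteq># mset xs" "P a" "P b"
  shows "P (sort xs ! 1)"
proof (rule ccontr)
  assume n: "\<not> P (sort xs ! 1)"
  have "size {#a, b#} \<le> size (mset xs)" using ab(1) by (rule size_mset_mono)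
  hence "length (sort xs) \<ge> 2" by simp
  then obtain y0 y1 ys where ys: "sort xs = y0 # y1 # ys"
    by (metis One_nat_def Suc_1 Suc_le_length_iff)
  have "sorted (y0 # y1 # ys)" using ys by (metis sorted_sort)
  hence "filter_mset P (mset (y1 # ys)) = {#}"
    using n down ys by auto
  moreover have "mset xs = add_mset y0 (mset (y1 # ys))" by (metis ys mset_sort mset.simps(2))
  ultimately have "size (filter_mset P (mset xs)) \<le> 1" by simp
  moreover have "filter_mset P {#a, b#} \<subseteq># filter_mset P (mset xs)"
    using ab(1) by (rule multiset_filter_mono)
  hence "size (filter_mset P {#a, b#}) \<le> size (filter_mset P (mset xs))" by (rule size_mset_mono)
  ultimately show False using ab by simp
qed

text \<open>If the second entry failed \<open>P\<close>, so would the first, but only the entry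
  \<open>a\<close> may fail.\<close>

lemma sort_second_upward:
  fixes xs :: "'a :: linorder list"
  assumes up: "\<And>x y. x \<le> y \<Longrightarrow> P x \<Longrightarrow> P y"
    and M: "mset xs = add_mset a M" "M \<noteq> {#}" "\<And>x. x \<in># M \<Longrightarrow> P x"
  shows "P (sort xs ! 1)"
proof (rule ccontr)
  assume n: "\<not> P (sort xs ! 1)"
  have "size (mset xs) = Suc (size M)" "size M > 0" using M by (simp_all add: nonempty_has_size)
  hence "length (sort xs) \<ge> 2" by simp
  then obtain y0 y1 ys where ys: "sort xs = y0 # y1 # ys"
    by (metis One_nat_def Suc_1 Suc_le_length_iff)
  have "sorted (y0 # y1 # ys)" using ys by (metis sorted_sort)
  hence "\<not> P y0" "\<not> P y1" using n up ys by auto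
  moreover have "mset xs = add_mset y0 (add_mset y1 (mset ys))" by (metis ys mset_sort mset.simps(2))
  ultimately have "size (filter_mset (\<lambda>x. \<not> P x) (mset xs)) \<ge> 2" by simp
  moreover have e: "filter_mset (\<lambda>x. \<not> P x) M = {#}" using M(3) by auto
  have "size (filter_mset (\<lambda>x. \<not> P x) (mset xs)) \<le> 1" unfolding M(1) by (simp add: e)
  ultimately show False by simp
qed

section \<open>Second eigenvalues from real roots\<close>

lemma proots_prod_linear:
  "proots (\<Prod>x\<in>#E. [:- f x, 1 :: 'a :: idom:]) = image_mset f E"
proof (induction E)
  case (add x E)
  have "proots ([:- f x, 1:] * (\<Prod>x\<in>#E. [:- f x, 1:])) = {#f x#} + image_mset f E"
    by (subst proots_mult) (auto simp: prod_mset_zero_iff add.IH)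
  thus ?case by (simp only: image_mset_add_mset prod_mset.add_mset) simp
qed simp

lemma prod_linear_of_real:
  "map_poly complex_of_real (\<Prod>x\<in>#E. [:- x, 1:]) = (\<Prod>x\<in>#E. [:- of_real x, 1:])"
proof -
  interpret map_poly_comm_ring_hom complex_of_real ..
  show ?thesis
  proof (induction E)
    case (add x E)
    have "map_poly complex_of_real ([:- x, 1:] * (\<Prod>x\<in>#E. [:- x, 1:])) =
        map_poly complex_of_real [:- x, 1:] * (\<Prod>x\<in>#E. [:- of_real x, 1:])"
      by (simp only: hom_mult add.IH)
    thus ?case by (simp only: image_mset_add_mset prod_mset.add_mset) (simp add: map_poly_pCons)
  qed simp
qed

lemma real_char_poly_spectrum:
  assumes A: "A \<in> carrier_mat k k" and k: "k \<ge> 2"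
    and fac: "char_poly A = (\<Prod>x\<in>#E. [:- x, 1:])" and xs: "mset xs = E"
  shows "spectrum (complex_mat A) \<subseteq> \<real>" "lambda2 A = of_real (sort xs ! 1)"
proof -
  have cp: "char_poly (complex_mat A) = (\<Prod>x\<in>#E. [:- of_real x, 1:])"
    unfolding of_real_hom.char_poly_hom[OF A] fac by (rule prod_linear_of_real)
  hence pr: "proots (char_poly (complex_mat A)) = image_mset of_real E"
    by (simp add: proots_prod_linear)
  have cA: "complex_mat A \<in> carrier_mat k k" using A by simp
  have nz: "char_poly (complex_mat A) \<noteq> 0"
    using degree_monic_char_poly[OF cA] by auto
  have "spectrum (complex_mat A) = set_mset (image_mset of_real E)"
    unfolding spectrum_root_char_poly[OF cA] pr[symmetric] using nz by simp
  thus "spectrum (complex_mat A) \<subseteq> \<real>" by auto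
  have "Re (lambda2 A) = sort (map Re (map of_real xs)) ! 1"
    by (rule Re_lambda2[OF A k]) (simp add: pr xs)
  hence Re: "Re (lambda2 A) = sort xs ! 1" by (simp add: comp_def)
  \<comment> \<open>The list chosen inside \<open>lambda2\<close> has only real members, so
    \<open>lambda2\<close> is determined by its real part, which does not depend on the
    choice.\<close>
  define fs where "fs = (SOME es. mset es = proots (char_poly (complex_mat A)))"
  have fs: "mset fs = image_mset of_real E" unfolding fs_def pr[symmetric] by (rule mset_proots_choice)
  have "size (proots (char_poly (complex_mat A))) = k"
    using size_proots_complex degree_monic_char_poly[OF cA] by metis
  hence "length (sort_key Re fs) = k" by (metis fs pr length_sort size_mset)
  hence "sort_key Re fs ! 1 \<in> set (sort_key Re fs)" using k by (intro nth_mem) simp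
  hence "lambda2 A \<in># image_mset of_real E"
    unfolding fs[symmetric] by (simp add: lambda2_def fs_def)
  hence "lambda2 A = of_real (Re (lambda2 A))" by auto
  thus "lambda2 A = of_real (sort xs ! 1)" unfolding Re .
qed

text \<open>Distinct real roots occupy two different positions in the eigenvalue list, whatever the
  remaining complex eigenvalues are.\<close>

lemma Re_lambda2_two_roots:
  assumes A: "A \<in> carrier_mat k k" and k: "k \<ge> 2"
    and down: "\<And>x y. x \<le> y \<Longrightarrow> P y \<Longrightarrow> P x"
    and ab: "a \<noteq> b" "poly (char_poly A) a = 0" "poly (char_poly A) b = 0" "P a" "P b"
  shows "P (Re (lambda2 A))"
proof -
  have cA: "complex_mat A \<in> carrier_mat k k" using A by simp
  let ?p = "char_poly (complex_mat A)"
  have nz: "?p \<noteq> 0" using degree_monic_char_poly[OF cA] by auto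
  obtain es where es: "mset es = proots ?p" using ex_mset by blast
  have root: "poly ?p (of_real x) = 0" if "poly (char_poly A) x = 0" for x
    unfolding of_real_hom.char_poly_hom[OF A] using that by simp
  have "mset_set {complex_of_real a, of_real b} \<subseteq># proots ?p"
  proof (rule mset_subset_eqI)
    fix z show "count (mset_set {complex_of_real a, of_real b}) z \<le> count (proots ?p) z"
      using root[OF ab(2)] root[OF ab(3)] nz by (auto simp: count_mset_set' order_root)
  qed
  hence "{#complex_of_real a, of_real b#} \<subseteq># mset es" using ab(1) by (simp add: es)
  hence "{#a, b#} \<subseteq># mset (map Re es)"
    using image_mset_subseteq_mono[of "{#complex_of_real a, of_real b#}" "mset es" Re] by simp
  thus ?thesis unfolding Re_lambda2[OF A k es]
    using sort_second_downward[of P a b "map Re es"] down ab by blast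
qed

section \<open>Perturbation of monic polynomials with simple real roots\<close>

lemma finite_separation:
  fixes R :: "real set"
  assumes "finite R"
  obtains \<eta> where "\<eta> > 0" "\<And>r r'. r \<in> R \<Longrightarrow> r' \<in> R \<Longrightarrow> r \<noteq> r' \<Longrightarrow> 2 * \<eta> < \<bar>r - r'\<bar>"
proof -
  \<comment> \<open>The extra 1 keeps the minimum defined when \<open>R\<close> has fewer than two
    elements.\<close>
  define D where "D = insert 1 ((\<lambda>(r, r'). \<bar>r - r'\<bar>) ` {p \<in> R \<times> R. fst p \<noteq> snd p})"
  have D: "finite D" "D \<noteq> {}" "\<forall>d\<in>D. d > 0" using assms by (auto simp: D_def)
  show thesis
  proof (rule that[of "Min D / 3"])
    show "Min D / 3 > 0" using D by simp
    fix r r' assume "r \<in> R" "r' \<in> R" "r \<noteq> r'"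
    hence "\<bar>r - r'\<bar> \<in> D" by (force simp: D_def)
    hence "Min D \<le> \<bar>r - r'\<bar>" "Min D > 0" using D by auto
    thus "2 * (Min D / 3) < \<bar>r - r'\<bar>" by linarith
  qed
qed

text \<open>Used to transport the sign of a product of linear factors between two points that no
  root separates.\<close>

lemma prod_same_side_pos:
  fixes x y :: "'a :: linordered_idom"
  assumes "\<And>r. r \<in> R \<Longrightarrow> 0 < (x - r) * (y - r)"
  shows "0 < (\<Prod>r\<in>R. x - r) * (\<Prod>r\<in>R. y - r)"
  unfolding prod.distrib[symmetric] using assms by (rule prod_pos)

text \<open>Each root of the comparison polynomial \<open>\<Prod>r\<in>R. x - r\<close> is trapped between two points at which
  \<open>p\<close> has the sign of that polynomial, so \<open>p\<close> changes sign there; as there are \<open>degree p\<close> such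
  intervals, this exhausts the roots of \<open>p\<close>. The last clause compares the signs of \<open>p\<close> at \<open>r\<close>
  and just to the right of \<open>r\<close>.\<close>

lemma perturbed_simple_roots:
  fixes p :: "real poly"
  assumes R: "finite R" and \<eta>: "\<eta> > 0"
    and sep: "\<And>r r'. r \<in> R \<Longrightarrow> r' \<in> R \<Longrightarrow> r \<noteq> r' \<Longrightarrow> 2 * \<eta> < \<bar>r - r'\<bar>"
    and deg: "degree p = card R" and lc: "lead_coeff p = 1"
    and near: "\<And>r x. r \<in> R \<Longrightarrow> x = r - \<eta> \<or> x = r + \<eta> \<Longrightarrow> 0 < poly p x * (\<Prod>r\<in>R. x - r)"
  shows "\<exists>f. p = (\<Prod>r\<in>R. [:- f r, 1:]) \<and> (\<forall>r\<in>R. \<bar>f r - r\<bar> < \<eta>) \<and>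
    (\<forall>r\<in>R. poly p r * (\<Prod>r'\<in>R - {r}. r - r') < 0 \<longrightarrow> r < f r)"
proof -
  define c where "c x = (\<Prod>r\<in>R. x - r)" for x
  have ex: "\<exists>y. \<bar>y - r\<bar> < \<eta> \<and> poly p y = 0 \<and> (poly p r * (\<Prod>r'\<in>R - {r}. r - r') < 0 \<longrightarrow> r < y)"
    if r: "r \<in> R" for r
  proof -
    have split: "c x = (x - r) * (\<Prod>r'\<in>R - {r}. x - r')" for x
      unfolding c_def using R r by (rule prod.remove)
    \<comment> \<open>All other elements of \<open>R\<close> are more than \<open>2 * \<eta>\<close>
      away from \<open>r\<close>, so none of them separates two of the three test points.\<close>
    have side: "0 < (\<Prod>r'\<in>R - {r}. x - r') * (\<Prod>r'\<in>R - {r}. y - r')"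
      if "x \<in> {r - \<eta>, r, r + \<eta>}" "y \<in> {r - \<eta>, r, r + \<eta>}" for x y
    proof (rule prod_same_side_pos)
      fix r' assume "r' \<in> R - {r}"
      hence "2 * \<eta> < \<bar>r - r'\<bar>" using sep r by auto
      thus "0 < (x - r') * (y - r')"
        using that \<eta>
        by (cases "r < r'") (auto simp: abs_if split: if_splits intro: mult_neg_neg mult_pos_pos)
    qed
    have np: "0 < poly p x * c x" if "x = r - \<eta> \<or> x = r + \<eta>" for x
      using near[OF r that] by (simp add: c_def)
    show ?thesis
    proof (cases "poly p r * (\<Prod>r'\<in>R - {r}. r - r') < 0")
      case True
      \<comment> \<open>At \<open>r\<close> the sign of \<open>p\<close> is opposite to that of the
        comparison polynomial just to the right, while at \<open>r + \<eta>\<close> they agree: the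
        root lies strictly to the right of \<open>r\<close>.\<close>
      have "0 < \<eta> * (poly p (r + \<eta>) * (\<Prod>r'\<in>R - {r}. r + \<eta> - r'))"
        using np[of "r + \<eta>"] by (simp add: split mult_ac)
      hence "0 < poly p (r + \<eta>) * (\<Prod>r'\<in>R - {r}. r + \<eta> - r')"
        using \<eta> by (rule zero_less_mult_pos)
      hence "poly p r * poly p (r + \<eta>) < 0"
        using True side[of "r + \<eta>" r] by (auto simp: zero_less_mult_iff mult_less_0_iff)
      then obtain y where "y > r" "y < r + \<eta>" "poly p y = 0"
        using poly_IVT[of r "r + \<eta>" p] \<eta> by auto
      thus ?thesis by (intro exI[of _ y]) auto
    next
      case False
      \<comment> \<open>Here only the sign change of the comparison polynomial across its simple
        root \<open>r\<close> is used.\<close>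
      have "c (r - \<eta>) * c (r + \<eta>) < 0"
        using side[of "r - \<eta>" "r + \<eta>"] \<eta>
        by (auto simp: split zero_less_mult_iff mult_less_0_iff)
      hence "poly p (r - \<eta>) * poly p (r + \<eta>) < 0"
        using np[of "r - \<eta>"] np[of "r + \<eta>"] by (auto simp: zero_less_mult_iff mult_less_0_iff)
      then obtain y where "y > r - \<eta>" "y < r + \<eta>" "poly p y = 0"
        using poly_IVT[of "r - \<eta>" "r + \<eta>" p] \<eta> by auto
      thus ?thesis using False by (intro exI[of _ y]) (auto simp: abs_if)
    qed
  qed
  then obtain f where f: "\<And>r. r \<in> R \<Longrightarrow> \<bar>f r - r\<bar> < \<eta>" "\<And>r. r \<in> R \<Longrightarrow> poly p (f r) = 0"
    "\<And>r. r \<in> R \<Longrightarrow> poly p r * (\<Prod>r'\<in>R - {r}. r - r') < 0 \<Longrightarrow> r < f r"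
    by metis
  have inj: "inj_on f R"
  proof (rule inj_onI)
    fix r r' assume r: "r \<in> R" "r' \<in> R" "f r = f r'"
    have "\<bar>r - r'\<bar> < 2 * \<eta>" using f(1)[OF r(1)] f(1)[OF r(2)] r(3) by (auto simp: abs_if split: if_splits)
    thus "r = r'" using sep[OF r(1,2)] by force
  qed
  have deg': "degree (\<Prod>r\<in>R. [:- f r, 1:]) = card R"
    using R by (subst degree_prod_eq_sum_degree) auto
  have lc': "lead_coeff (\<Prod>r\<in>R. [:- f r, 1:]) = 1"
    by (simp add: lead_coeff_prod)
  \<comment> \<open>Two monic polynomials of degree \<open>card R\<close> that agree at the
    \<open>card R\<close> distinct points \<open>f r\<close>.\<close>
  have "p = (\<Prod>r\<in>R. [:- f r, 1:])"
  proof (rule poly_eqI_degree_lead_coeff)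
    show "coeff p (card R) = coeff (\<Prod>r\<in>R. [:- f r, 1:]) (card R)"
      using deg lc deg' lc' by simp
    show "card R \<le> card (f ` R)" using inj by (simp add: card_image)
    show "poly p z = poly (\<Prod>r\<in>R. [:- f r, 1:]) z" if "z \<in> f ` R" for z
      using that f(2) R by (auto simp: poly_prod)
  qed (use deg deg' in auto)
  thus ?thesis using f by blast
qed

subsection \<open>The moving factor of the characteristic polynomial\<close>

lemma alpha_even_reflect:
  assumes "k \<le> n" "n > 0"
  shows "alpha n (2 * (n - k)) = alpha n (2 * k)"
proof -
  have "2 * pi * real (n - k) / real n = 2 * pi - 2 * pi * real k / real n"
    using assms by (simp add: of_nat_diff field_simps)
  thus ?thesis unfolding alpha_even by (simp add: cos_diff)
qed

lemma alpha_strict_mono: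
  assumes "k < l" "l \<le> n"
  shows "alpha n k < alpha n l"
proof -
  have n: "real n > 0" "real l \<le> real n" using assms by auto
  have "cos (real l * pi / real n) < cos (real k * pi / real n)"
  proof (rule cos_monotone_0_pi)
    show "real k * pi / real n < real l * pi / real n"
      using assms n by (simp add: divide_strict_right_mono)
    show "real l * pi / real n \<le> pi" using n by (simp add: field_simps)
  qed simp
  thus ?thesis by (simp add: alpha_def)
qed

lemma alpha_even_strict_mono: "k < l \<Longrightarrow> l \<le> n div 2 \<Longrightarrow> alpha n (2 * k) < alpha n (2 * l)"
  by (rule alpha_strict_mono) auto

lemma alpha_0 [simp]: "alpha n 0 = 0"
  by (simp add: alpha_def)

lemma alpha_le_4: "alpha n l \<le> 4"
  using cos_ge_minus_one[of "real l * pi / real n"]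
  unfolding alpha_def right_diff_distrib by linarith

text \<open>The reflection of \<open>k\<close> to \<open>n - k\<close> reduces to
  \<open>k \<le> n div 2\<close>, where the values increase strictly.\<close>

lemma alpha_2_least:
  assumes n: "n \<ge> 3" and k: "1 \<le> k" "k < n"
  shows "alpha n 2 \<le> alpha n (2 * k)" "alpha n (2 * k) = alpha n 2 \<longleftrightarrow> k = 1 \<or> k = n - 1"
proof -
  have *: "alpha n (2 * 1) \<le> alpha n (2 * l) \<and> (alpha n (2 * l) = alpha n (2 * 1) \<longleftrightarrow> l = 1)"
    if "1 \<le> l" "l \<le> n div 2" for l
    using alpha_even_strict_mono[of 1 l n] that by (cases "l = 1") auto
  have "alpha n 2 \<le> alpha n (2 * k) \<and> (alpha n (2 * k) = alpha n 2 \<longleftrightarrow> k = 1 \<or> k = n - 1)"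
  proof (cases "k \<le> n div 2")
    case True
    have "k = n - 1 \<longrightarrow> k = 1" using True n by auto
    thus ?thesis using *[of k] True k by auto
  next
    case False
    have "k \<noteq> 1" using False n by auto
    moreover have "k = n - 1 \<longleftrightarrow> n - k = 1" using k by auto
    moreover have "1 \<le> n - k" "n - k \<le> n div 2" using False k by auto
    ultimately show ?thesis using *[of "n - k"] alpha_even_reflect[of k n] k by simp
  qed
  thus "alpha n 2 \<le> alpha n (2 * k)" "alpha n (2 * k) = alpha n 2 \<longleftrightarrow> k = 1 \<or> k = n - 1" by auto
qed

section \<open>The fixed data of the graph and the factorised characteristic polynomial\<close>

definition root_poly :: "real set \<Rightarrow> real poly" where
  "root_poly S = (\<Prod>v\<in>S. [:- v, 1:])"

lemma poly_root_poly: "poly (root_poly S) x = (\<Prod>v\<in>S. x - v)"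
  by (simp add: root_poly_def poly_prod)

lemma root_poly_remove:
  "finite S \<Longrightarrow> v \<in> S \<Longrightarrow> poly (root_poly S) x = (x - v) * poly (root_poly (S - {v})) x"
  unfolding poly_root_poly by (rule prod.remove)

lemma poly_root_poly_eq_0: "finite S \<Longrightarrow> poly (root_poly S) x = 0 \<longleftrightarrow> x \<in> S"
  by (auto simp: poly_root_poly prod_zero_iff)

text \<open>The modification is not a parameter, because smallness thresholds must be uniform over
  all modifications.\<close>

locale cycle_star =
  fixes n m :: nat and w :: "nat \<Rightarrow> real"
  assumes n: "n \<ge> 3" and m: "m \<ge> 4"
    and w_nonneg: "\<And>i. i < n \<Longrightarrow> w i \<ge> 0" and w0: "w 0 > 0"
begin

abbreviation a :: "nat \<Rightarrow> real" where "a k \<equiv> alpha n (2 * k)"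

definition W :: real where "W = (\<Sum>i<n. w i)"

definition star_poly :: "real poly" where "star_poly = [:W, - (real m + W), 1:]"

definition q :: "real \<Rightarrow> real" where "q x = x\<^sup>2 - (real m + W) * x + W"

definition \<beta> :: real where "\<beta> = beta_minus m W"

definition \<beta>' :: real where "\<beta>' = (real m + W + sqrt ((real m + W)\<^sup>2 - 4 * W)) / 2"

text \<open>The cycle spectrum without multiplicities: the indices \<open>k\<close> and
  \<open>n - k\<close> give the same element.\<close>

definition V :: "real set" where "V = a ` {..<n}"

definition fourier_w :: "nat \<Rightarrow> real" where
  "fourier_w k = (\<Sum>i<n. w i * cos (2 * pi * real k * real i / real n))"

definition total :: "(nat \<Rightarrow> real) \<Rightarrow> real" where "total \<delta> = (\<Sum>i<m. \<delta> i)"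

text \<open>The correction factor of the characteristic polynomial, multiplied by
  \<open>star_poly\<close> and by one copy of each distinct cycle factor; this clears all its
  denominators.\<close>

definition moving_poly :: "(nat \<Rightarrow> real) \<Rightarrow> real poly" where
  "moving_poly \<delta> = root_poly V * star_poly - Polynomial.smult (1 / real n)
     (\<Sum>k<n. root_poly (V - {a k}) *
        (Polynomial.smult (total \<delta>) star_poly - Polynomial.smult (fourier_w k) [:total \<delta>, - \<delta> 0:]))"

lemma poly_star_poly: "poly star_poly x = q x"
  by (simp add: star_poly_def q_def power2_eq_square algebra_simps)

lemma W_pos: "W > 0"
proof -
  have "w 0 \<le> W" unfolding W_def using n w_nonneg by (intro member_le_sum) auto
  thus ?thesis using w0 by simp
qed

text \<open>The discriminant is \<open>(m + W - 2)\<^sup>2 + 4 * (m - 1)\<close>, which gives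
  \<beta> < 1, and also \<open>(m - W)\<^sup>2 + 4 * W * (m - 1)\<close>, which puts \<beta>' above
  \<open>m\<close>, hence above 4.\<close>

lemma q_roots: "q x = (x - \<beta>) * (x - \<beta>')" "0 < \<beta>" "\<beta> < 1" "4 < \<beta>'"
proof -
  define d where "d = (real m + W)\<^sup>2 - 4 * W"
  have m4: "real m \<ge> 4" using m by simp
  have d1: "d = (real m + W - 2)\<^sup>2 + 4 * (real m - 1)"
    and d2: "d = (real m - W)\<^sup>2 + 4 * W * (real m - 1)"
    by (simp_all add: d_def power2_eq_square algebra_simps)
  have "d \<ge> 0" unfolding d1 using m4 by (intro add_nonneg_nonneg) auto
  hence s2: "(sqrt d)\<^sup>2 = d" by simp
  have "sqrt d < real m + W" using W_pos m4 by (intro real_less_lsqrt) (auto simp: d_def)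
  moreover have "real m + W - 2 < sqrt d" using m4 by (intro real_less_rsqrt) (simp add: d1)
  moreover have "real m - W < sqrt d" using m4 W_pos by (intro real_less_rsqrt) (simp add: d2)
  ultimately show "0 < \<beta>" "\<beta> < 1" "4 < \<beta>'"
    using m4 by (auto simp: \<beta>_def \<beta>'_def beta_minus_def d_def)
  have "(x - \<beta>) * (x - \<beta>') = x\<^sup>2 - (real m + W) * x + ((real m + W)\<^sup>2 - (sqrt d)\<^sup>2) / 4"
    unfolding \<beta>_def \<beta>'_def beta_minus_def d_def[symmetric] by (simp add: power2_eq_square field_simps)
  thus "q x = (x - \<beta>) * (x - \<beta>')" unfolding s2 by (simp add: d_def q_def)
qed

lemma V_eq: "V = a ` {..n div 2}" "inj_on a {..n div 2}"
proof -
  have "a ` {..<n} \<subseteq> a ` {..n div 2}"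
  proof
    fix v assume "v \<in> a ` {..<n}"
    then obtain k where k: "k < n" "v = a k" by auto
    show "v \<in> a ` {..n div 2}"
    proof (cases "k \<le> n div 2")
      case False
      hence "n - k \<le> n div 2" using k by auto
      moreover have "v = a (n - k)" using alpha_even_reflect[of k n] k by simp
      ultimately show ?thesis by blast
    qed (use k in auto)
  qed
  moreover have "{..n div 2} \<subseteq> {..<n}" using n by auto
  ultimately show "V = a ` {..n div 2}" unfolding V_def by blast
  show "inj_on a {..n div 2}"
  proof (rule linorder_inj_onI)
    fix k l assume "k < l" "k \<in> {..n div 2}" "l \<in> {..n div 2}"
    thus "a k \<noteq> a l" using alpha_even_strict_mono[of k l n] by simp
  qed auto
qed

lemma V_finite: "finite V" by (simp add: V_def)

lemma V_mem: "k < n \<Longrightarrow> a k \<in> V" by (auto simp: V_def)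

lemma V_0: "0 \<in> V" using V_mem[of 0] n by simp

lemma card_V: "card V = n div 2 + 1" unfolding V_eq(1) by (simp add: card_image[OF V_eq(2)])

lemma V_cases:
  assumes "v \<in> V"
  shows "v = 0 \<or> a 1 \<le> v"
proof -
  from assms obtain k where "k < n" "v = a k" by (auto simp: V_def)
  thus ?thesis using alpha_2_least(1)[OF n, of k] by (cases "k = 0") simp_all
qed

lemma a_1_pos: "0 < a 1" using alpha_even_strict_mono[of 0 1 n] n by auto

lemma V_le_4: "v \<in> V \<Longrightarrow> v \<le> 4" by (auto simp: V_def alpha_le_4)

text \<open>The indices up to \<open>n div 2\<close> list each distinct eigenvalue once; the
  remaining indices are the repetitions.\<close>

lemma prod_eigenvalues_cycle:
  fixes f :: "real \<Rightarrow> 'a :: comm_monoid_mult"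
  shows "(\<Prod>k<n. f (a k)) = (\<Prod>v\<in>V. f v) * (\<Prod>k\<in>{n div 2<..<n}. f (a k))"
proof -
  have "{..<n} = {..n div 2} \<union> {n div 2<..<n}" using n by auto
  moreover have "(\<Prod>v\<in>V. f v) = (\<Prod>k\<le>n div 2. f (a k))"
    unfolding V_eq(1) by (simp add: prod.reindex[OF V_eq(2)])
  ultimately show ?thesis by (simp add: prod.union_disjoint ivl_disj_int)
qed

lemma poly_moving_poly:
  "poly (moving_poly \<delta>) x = poly (root_poly V) x * q x -
     (\<Sum>k<n. poly (root_poly (V - {a k})) x *
        (total \<delta> * q x - (total \<delta> - \<delta> 0 * x) * fourier_w k)) / real n"
proof -
  have *: "poly (Polynomial.smult T star_poly - Polynomial.smult F [:T, - d:]) x = T * q x - (T - d * x) * F"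
    for T F d by (simp add: poly_star_poly algebra_simps)
  show ?thesis unfolding moving_poly_def
    by (subst poly_diff) (simp only: poly_smult poly_sum poly_mult * poly_star_poly, simp)
qed

lemma sum_w_cycle_resolvent:
  "(\<Sum>i<n. w i * cycle_resolvent n x i) = (\<Sum>k<n. fourier_w k / (x - a k)) / real n"
proof -
  have "(\<Sum>i<n. w i * cycle_resolvent n x i) =
      (\<Sum>i<n. \<Sum>k<n. w i * cos (2 * pi * real k * real i / real n) / (x - a k)) / real n"
    by (simp add: cycle_resolvent_def sum_distrib_left sum_divide_distrib)
  also have "\<dots> = (\<Sum>k<n. \<Sum>i<n. w i * cos (2 * pi * real k * real i / real n) / (x - a k)) / real n"
    by (subst sum.swap) simp
  finally show ?thesis by (simp add: fourier_w_def sum_divide_distrib)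
qed

text \<open>Off \<open>V\<close>, deleting a factor means dividing by \<open>x - a k\<close>, so the
  sums over modes become resolvent entries.\<close>

lemma poly_moving_poly_resolvent:
  assumes "x \<notin> V"
  shows "poly (moving_poly \<delta>) x = poly (root_poly V) x *
     (q x - total \<delta> * q x * cycle_resolvent n x 0 +
      (total \<delta> - \<delta> 0 * x) * (\<Sum>i<n. w i * cycle_resolvent n x i))"
proof -
  have *: "poly (root_poly (V - {a k})) x = poly (root_poly V) x / (x - a k)" if "k < n" for k
    using root_poly_remove[OF V_finite V_mem[OF that], of x] assms V_mem[OF that] by auto
  have res0: "cycle_resolvent n x 0 = (\<Sum>k<n. 1 / (x - a k)) / real n"
    by (simp add: cycle_resolvent_def)
  have distr: "P / d * (T - E * F) = P * T * (1 / d) - P * E * (F / d)" for P d T E F :: real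
    by (simp add: algebra_simps)
  have "(\<Sum>k<n. poly (root_poly (V - {a k})) x * (total \<delta> * q x - (total \<delta> - \<delta> 0 * x) * fourier_w k)) =
      (\<Sum>k<n. poly (root_poly V) x * (total \<delta> * q x) * (1 / (x - a k)) -
        poly (root_poly V) x * (total \<delta> - \<delta> 0 * x) * (fourier_w k / (x - a k)))"
    by (rule sum.cong[OF refl]) (simp only: * lessThan_iff distr)
  also have "\<dots> = poly (root_poly V) x * (total \<delta> * q x) * (\<Sum>k<n. 1 / (x - a k)) -
        poly (root_poly V) x * (total \<delta> - \<delta> 0 * x) * (\<Sum>k<n. fourier_w k / (x - a k))"
    by (simp only: sum_subtractf sum_distrib_left)
  finally have sum: "(\<Sum>k<n. poly (root_poly (V - {a k})) x *
      (total \<delta> * q x - (total \<delta> - \<delta> 0 * x) * fourier_w k)) = \<dots>" .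
  have "P * Q - (P * T * A - P * E * F) / N = P * (Q - T * (A / N) + E * (F / N))"
    for P Q T A E F N :: real
    by (simp add: algebra_simps diff_divide_distrib)
  thus ?thesis unfolding poly_moving_poly sum_w_cycle_resolvent res0 sum .
qed

text \<open>Away from \<open>V\<close>, \<beta> and \<beta>' no denominator vanishes and both sides
  agree, which is enough for polynomials.\<close>

lemma char_poly_L_Gp:
  "char_poly (L_Gp n m w \<delta>) =
     [:-1, 1:] ^ (m - 2) * (\<Prod>k\<in>{n div 2<..<n}. [:- a k, 1:]) * moving_poly \<delta>"
proof (rule poly_eqI_cofinite)
  show "finite (V \<union> {\<beta>, \<beta>'})" using V_finite by simp
  fix x assume x: "x \<notin> V \<union> {\<beta>, \<beta>'}"
  have qx: "q x \<noteq> 0" using x by (simp add: q_roots(1))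
  have "poly (char_poly (L_Gp n m w \<delta>)) x =
      (\<Prod>k<n. x - a k) * ((x - 1) ^ (m - 2) * q x) *
      (1 - total \<delta> * cycle_resolvent n x 0 +
        (total \<delta> - \<delta> 0 * x) * (\<Sum>i<n. w i * cycle_resolvent n x i) / q x)"
    unfolding W_def total_def q_def
    by (rule char_poly_L_Gp_eq) (use n m x qx V_mem in \<open>auto simp: W_def q_def\<close>)
  also have "\<dots> = (x - 1) ^ (m - 2) * (\<Prod>k\<in>{n div 2<..<n}. x - a k) * (poly (root_poly V) x *
      (q x - total \<delta> * q x * cycle_resolvent n x 0 +
        (total \<delta> - \<delta> 0 * x) * (\<Sum>i<n. w i * cycle_resolvent n x i)))"
  proof -
    have "(P * A) * (X * Q) * (1 - T * G + E / Q) = X * A * (P * (Q - T * Q * G + E))"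
      if "Q \<noteq> 0" for P A X Q T G E :: real
      using that by (simp add: field_simps)
    from this[OF qx] show ?thesis
      unfolding prod_eigenvalues_cycle[of "\<lambda>v. x - v"] poly_root_poly .
  qed
  also have "\<dots> = (x - 1) ^ (m - 2) * (\<Prod>k\<in>{n div 2<..<n}. x - a k) * poly (moving_poly \<delta>) x"
    using x by (subst poly_moving_poly_resolvent) auto
  finally show "poly (char_poly (L_Gp n m w \<delta>)) x = poly ([:-1, 1:] ^ (m - 2) *
      (\<Prod>k\<in>{n div 2<..<n}. [:- a k, 1:]) * moving_poly \<delta>) x"
    by (simp add: poly_power poly_prod)
qed

end

subsection \<open>Signs of the moving factor\<close>

text \<open>A cosine centred at \<open>n / 2\<close> solves the homogeneous recurrence at every node
  except 0, where its defect is \<open>2 * sin t * sin (n * t / 2)\<close>; dividing by the defect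
  gives the resolvent column.\<close>

lemma cycle_resolvent_closed_form:
  assumes n: "n \<ge> 3" and i: "i < n" and x: "\<And>k. k < n \<Longrightarrow> x \<noteq> alpha n (2 * k)"
    and xt: "x = 2 - 2 * cos t" and d: "2 * sin t * sin (real n * t / 2) \<noteq> 0" (is "?d \<noteq> 0")
  shows "cycle_resolvent n x i = cos ((real n / 2 - real i) * t) / (2 * sin t * sin (real n * t / 2))"
proof -
  let ?L = "laplacian (cycle_adj n)"
  define M where "M = x \<cdot>\<^sub>m 1\<^sub>m n - ?L"
  define y where "y i = cos ((real n / 2 - real i) * t)" for i :: nat
  have L: "?L \<in> carrier_mat n n" by (simp add: laplacian_cycle[OF n])
  have M: "M \<in> carrier_mat n n" unfolding M_def using L by (rule minus_carrier_mat)
  have row: "(\<Sum>j<n. M $$ (i, j) * z j) = x * z i - (\<Sum>j<n. ?L $$ (i, j) * z j)" if "i < n" for i z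
  proof -
    have "(\<Sum>j<n. M $$ (i, j) * z j) = (\<Sum>j<n. (if i = j then x * z j else 0) - ?L $$ (i, j) * z j)"
      by (rule sum.cong) (use that L in \<open>auto simp: M_def algebra_simps\<close>)
    thus ?thesis using that by (simp add: sum_subtractf)
  qed
  have cs: "cos (u - t) + cos (u + t) = 2 * cos t * cos u" for u
    by (simp add: cos_add cos_diff)
  \<comment> \<open>Closing the cycle works because the angles at positions 0 and \<open>n\<close>
    are opposite and cosine is even.\<close>
  have y_wrap: "y (Suc i mod n) = cos ((real n / 2 - real i) * t - t)" if "i < n" for i
  proof (cases "Suc i = n")
    case True
    have e: "(real n / 2 - real i) * t - t = - (real n / 2 * t)"
      using True by (auto simp: algebra_simps)
    show ?thesis unfolding e cos_minus using True by (simp add: y_def)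
  next
    case False
    thus ?thesis using that by (simp add: y_def algebra_simps)
  qed
  have y_row: "x * y i - (\<Sum>j<n. ?L $$ (i, j) * y j) = (if i = 0 then ?d else 0)" if i: "i < n" for i
  proof (cases "i = 0")
    case True
    define u where "u = real n * t / 2"
    have "y (n - 1) = cos (t - u)"
      using n by (simp add: y_def u_def of_nat_diff algebra_simps)
    moreover have "y 0 = cos u" by (simp add: y_def u_def)
    moreover have "y (Suc 0 mod n) = cos (u - t)" using y_wrap[of 0] n by (simp add: u_def)
    moreover have d: "?d = 2 * sin t * sin u" by (simp add: u_def)
    ultimately show ?thesis unfolding sum_row_laplacian_cycle[OF n i] d using True
      by (simp add: xt cos_diff algebra_simps)
  next
    case False
    have "y (i - 1) = cos ((real n / 2 - real i) * t + t)"
      using False by (simp add: y_def of_nat_diff algebra_simps)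
    moreover note y_wrap[OF i] cs[of "(real n / 2 - real i) * t"]
    ultimately show ?thesis unfolding sum_row_laplacian_cycle[OF n i] using False
      by (simp add: xt left_diff_distrib y_def)
  qed
  \<comment> \<open>Both solutions of the same system yield the same cofactor, and the nonzero
    determinant cancels.\<close>
  have "cofactor M 0 i = det M * (y i / ?d)"
  proof (rule cofactor_first_row[OF M i])
    fix i assume i: "i < n"
    have "(\<Sum>j<n. M $$ (i, j) * (y j / ?d)) = (\<Sum>j<n. M $$ (i, j) * y j) / ?d"
      by (simp add: sum_divide_distrib)
    thus "(\<Sum>j<n. M $$ (i, j) * (y j / ?d)) = (if i = 0 then 1 else 0)"
      unfolding row[OF i] y_row[OF i] using d by simp
  qed
  moreover have "cofactor M 0 i = det M * cycle_resolvent n x i"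
    by (rule cofactor_first_row[OF M i]) (use cycle_resolvent[OF n _ x] in \<open>simp add: row\<close>)
  moreover have "det M \<noteq> 0"
    using x unfolding M_def poly_char_poly_det[OF L, symmetric] char_poly_cycle[OF n] by auto
  ultimately have "cycle_resolvent n x i = y i / ?d" by (metis mult_left_cancel)
  thus ?thesis by (simp only: y_def)
qed

text \<open>Inverts \<open>b = 2 - 2 * cos t\<close> on \<open>[0, pi]\<close>, where this function
  increases, so comparing \<open>b\<close> with \<open>alpha n l\<close> compares \<open>t\<close>
  with \<open>l * pi / n\<close>.\<close>

lemma pi_minus_arccos_bounds:
  assumes n: "n \<ge> 1" and b: "0 < b" "b < alpha n l" "l \<le> n" and t: "t = pi - arccos ((b - 2) / 2)"
  shows "b = 2 - 2 * cos t" "0 < t" "real n * t < real l * pi"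
proof -
  have b4: "b < 4" using b alpha_le_4[of n l] by linarith
  have ct: "cos t = - ((b - 2) / 2)" unfolding t using b b4 by simp
  thus bt: "b = 2 - 2 * cos t" by (simp add: field_simps)
  have "arccos ((b - 2) / 2) < pi" using arccos_lt_bounded[of "(b - 2) / 2"] b b4 by auto
  moreover have "0 \<le> arccos ((b - 2) / 2)" using b b4 by (intro arccos_lbound) auto
  ultimately have tpi: "t \<le> pi" and "0 < t" by (auto simp: t)
  thus "0 < t" by simp
  show "real n * t < real l * pi"
  proof (rule ccontr)
    assume "\<not> real n * t < real l * pi"
    hence le: "real l * pi / real n \<le> t" using n by (simp add: field_simps)
    have "cos t \<le> cos (real l * pi / real n)"
      by (rule cos_monotone_0_pi_le[OF _ le tpi]) simp
    thus False using b bt by (simp add: alpha_def)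
  qed
qed

section \<open>Roots, degree and special values of the moving factor\<close>

context cycle_star
begin

text \<open>The roots of the unperturbed \<open>moving_poly\<close>, all simple once \<beta> lies
  outside \<open>V\<close>.\<close>

definition R :: "real set" where "R = insert \<beta> (insert \<beta>' V)"

lemma R_finite: "finite R" by (simp add: R_def V_finite)

lemma \<beta>'_notin: "\<beta>' \<notin> V" "\<beta> \<noteq> \<beta>'"
  using V_le_4 q_roots by force+

lemma prod_R:
  assumes "\<beta> \<notin> V"
  shows "(\<Prod>r\<in>R. x - r) = poly (root_poly V) x * q x"
  unfolding R_def q_roots(1) poly_root_poly using assms \<beta>'_notin V_finite by simp

lemma moving_poly_zero:
  assumes "\<beta> \<notin> V"
  shows "moving_poly (\<lambda>_. 0) = (\<Prod>r\<in>R. [:- r, 1:])"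
proof (rule poly_ext)
  fix x
  show "poly (moving_poly (\<lambda>_. 0)) x = poly (\<Prod>r\<in>R. [:- r, 1:]) x"
    by (simp add: poly_moving_poly total_def poly_prod prod_R[OF assms])
qed

text \<open>Read off from the monic characteristic polynomial of degree \<open>n + m\<close> by
  removing the monic fixed factors, which leaves degree \<open>n div 2 + 3\<close>.\<close>

lemma monic_moving_poly:
  assumes "\<beta> \<notin> V"
  shows "degree (moving_poly \<delta>) = card R" "lead_coeff (moving_poly \<delta>) = 1"
proof -
  let ?A = "[:-1, 1:] ^ (m - 2) * (\<Prod>k\<in>{n div 2<..<n}. [:- a k, 1:])"
  have A1: "lead_coeff ?A = 1" by (simp add: lead_coeff_mult lead_coeff_power lead_coeff_prod)
  hence A0: "?A \<noteq> 0" by auto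
  have "degree ?A = (m - 2) + (n - Suc (n div 2))"
    by (subst degree_mult_eq) (auto simp: degree_power_eq degree_prod_eq_sum_degree prod_zero_iff)
  moreover have c: "degree (char_poly (L_Gp n m w \<delta>)) = n + m \<and> coeff (char_poly (L_Gp n m w \<delta>)) (n + m) = 1"
    by (rule degree_monic_char_poly[OF L_Gp_carrier])
  moreover have "moving_poly \<delta> \<noteq> 0" using c by (auto simp: char_poly_L_Gp)
  hence "degree (char_poly (L_Gp n m w \<delta>)) = degree ?A + degree (moving_poly \<delta>)"
    unfolding char_poly_L_Gp using A0 by (rule degree_mult_eq[rotated])
  ultimately have "n + m = (m - 2) + (n - Suc (n div 2)) + degree (moving_poly \<delta>)" by simp
  moreover have "card R = n div 2 + 3"
    unfolding R_def using assms \<beta>'_notin V_finite by (simp add: card_V)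
  ultimately show "degree (moving_poly \<delta>) = card R" using n m by linarith
  have "lead_coeff (char_poly (L_Gp n m w \<delta>)) = 1" using c by simp
  thus "lead_coeff (moving_poly \<delta>) = 1" unfolding char_poly_L_Gp lead_coeff_mult[of ?A] A1 by simp
qed

lemma fourier_w_0: "fourier_w 0 = W"
  by (simp add: fourier_w_def W_def)

lemma fourier_w_le: "fourier_w k \<le> W"
  unfolding fourier_w_def W_def
  by (intro sum_mono) (use w_nonneg in \<open>auto intro: mult_left_le\<close>)

lemma fourier_w_reflect: "fourier_w (n - 1) = fourier_w 1"
  unfolding fourier_w_def
proof (intro sum.cong refl arg_cong2[of _ _ _ _ "(*)"])
  fix i
  have "2 * pi * real (n - 1) * real i / real n = 2 * pi * real i - 2 * pi * real 1 * real i / real n"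
    using n by (simp add: of_nat_diff field_simps)
  moreover have "cos (2 * pi * real i) = 1" "sin (2 * pi * real i) = 0"
    using cos_int_2pin[of "int i"] sin_int_2pin[of "int i"] by (simp_all only: of_int_of_nat_eq)
  ultimately show "cos (2 * pi * real (n - 1) * real i / real n) = cos (2 * pi * real 1 * real i / real n)"
    by (simp only: cos_diff)
qed

text \<open>Modes \<open>k > 0\<close> keep the factor \<open>x\<close>, and mode 0 contributes
  \<open>total \<delta> * W - total \<delta> * W\<close>.\<close>

lemma moving_poly_at_0: "poly (moving_poly \<delta>) 0 = 0"
proof -
  have "poly (root_poly (V - {a k})) 0 * (total \<delta> * q 0 - (total \<delta> - \<delta> 0 * 0) * fourier_w k) = 0"
    if "k < n" for k
  proof (cases "k = 0")
    case True
    thus ?thesis by (simp add: fourier_w_0 q_def)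
  next
    case False
    hence "a k \<noteq> 0" using alpha_2_least(1)[OF n, of k] that a_1_pos by simp
    thus ?thesis using V_0 V_finite by (simp add: poly_root_poly_eq_0)
  qed
  hence sum: "(\<Sum>k<n. poly (root_poly (V - {a k})) 0 *
      (total \<delta> * q 0 - (total \<delta> - \<delta> 0 * 0) * fourier_w k)) = 0"
    by (intro sum.neutral ballI) (simp only: lessThan_iff)
  have "poly (root_poly V) 0 = 0" using V_0 V_finite by (simp add: poly_root_poly_eq_0)
  thus ?thesis unfolding poly_moving_poly sum by simp
qed

lemma S_coeff_eq:
  "S_coeff n m w \<delta> = total \<delta> - (total \<delta> - \<delta> 0 * a 1) / q (a 1) * fourier_w 1"
  unfolding S_coeff_def Let_def total_def q_def W_def fourier_w_def by (simp add: mult_ac)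

text \<open>Only the modes 1 and \<open>n - 1\<close> lose the factor vanishing at
  \<open>a 1\<close>; their contributions are equal, whence the 2.\<close>

lemma moving_poly_at_a_1:
  assumes "q (a 1) \<noteq> 0"
  shows "poly (moving_poly \<delta>) (a 1) =
    - (2 / real n) * poly (root_poly (V - {a 1})) (a 1) * q (a 1) * S_coeff n m w \<delta>"
proof -
  let ?F = "total \<delta> * q (a 1) - (total \<delta> - \<delta> 0 * a 1) * fourier_w 1"
  let ?f = "\<lambda>k. poly (root_poly (V - {a k})) (a 1) *
    (total \<delta> * q (a 1) - (total \<delta> - \<delta> 0 * a 1) * fourier_w k)"
  have V1: "a 1 \<in> V" using V_mem[of 1] n by simp
  have "?f k = 0" if "k \<in> {..<n} - {1, n - 1}" for k
  proof -
    have "a k \<noteq> a 1"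
    proof (cases "k = 0")
      case False
      thus ?thesis using alpha_2_least(2)[OF n, of k] that by auto
    qed (use a_1_pos in auto)
    hence "poly (root_poly (V - {a k})) (a 1) = 0"
      using V1 V_finite by (simp add: poly_root_poly_eq_0)
    thus ?thesis by simp
  qed
  hence "(\<Sum>k<n. ?f k) = (\<Sum>k\<in>{1, n - 1}. ?f k)"
    using n by (intro sum.mono_neutral_right) auto
  also have "\<dots> = ?f 1 + ?f (n - 1)" using n by simp
  also have "a (n - 1) = a 1" using alpha_even_reflect[of 1 n] n by simp
  finally have "(\<Sum>k<n. ?f k) = 2 * (poly (root_poly (V - {a 1})) (a 1) * ?F)"
    unfolding fourier_w_reflect by simp
  moreover have "poly (root_poly V) (a 1) = 0" using V1 V_finite by (simp add: poly_root_poly_eq_0)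
  moreover have "?F = q (a 1) * S_coeff n m w \<delta>"
    unfolding S_coeff_eq using assms by (simp add: right_diff_distrib)
  ultimately show ?thesis unfolding poly_moving_poly by simp
qed

text \<open>Since \<open>q \<beta> = 0\<close>, only the weighted resolvent term remains, and the
  closed form turns it into the cosine sum over a positive \<open>d\<close>.\<close>

lemma moving_poly_at_\<beta>:
  assumes "\<beta> \<notin> V" "\<beta> < a 1" and t: "t = pi - arccos ((\<beta> - 2) / 2)"
  obtains d where "d > 0" "\<And>\<delta>. poly (moving_poly \<delta>) \<beta> =
    poly (root_poly V) \<beta> * ((total \<delta> - \<delta> 0 * \<beta>) * (\<Sum>i<n. w i * cos ((real n / 2 - real i) * t)) / d)"
proof -
  have "\<beta> < alpha n 2" using assms by simp
  note b = pi_minus_arccos_bounds[OF _ q_roots(2) this _ t]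
  have bt: "\<beta> = 2 - 2 * cos t" and t0: "0 < t" and nt: "real n * t < 2 * pi" using b n by simp_all
  \<comment> \<open>With at least three nodes, \<open>n * t < 2 * pi\<close> forces
    \<open>t < pi\<close>, so both sines in the denominator are positive.\<close>
  have "3 * t \<le> real n * t" using t0 n by (intro mult_right_mono) auto
  hence "t < pi" using nt pi_gt_zero by linarith
  hence "0 < sin t" using t0 by (intro sin_gt_zero)
  moreover have "0 < sin (real n * t / 2)" using t0 nt n by (intro sin_gt_zero) auto
  ultimately have d: "0 < 2 * sin t * sin (real n * t / 2)" by simp
  have g: "cycle_resolvent n \<beta> i = cos ((real n / 2 - real i) * t) / (2 * sin t * sin (real n * t / 2))"
    if "i < n" for i
    by (rule cycle_resolvent_closed_form[OF n that _ bt]) (use V_mem assms(1) d in auto)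
  have "(\<Sum>i<n. w i * cycle_resolvent n \<beta> i) =
      (\<Sum>i<n. w i * cos ((real n / 2 - real i) * t)) / (2 * sin t * sin (real n * t / 2))"
    unfolding sum_divide_distrib by (rule sum.cong) (auto simp: g)
  moreover have "q \<beta> = 0" by (simp add: q_roots(1))
  ultimately show thesis using that[OF d] by (simp add: poly_moving_poly_resolvent[OF assms(1)])
qed

lemma modification_total:
  assumes "modification m \<delta>"
  shows "0 < total \<delta>" "0 \<le> \<delta> 0" "\<delta> 0 \<le> total \<delta>"
proof -
  have nn: "\<And>i. i < m \<Longrightarrow> 0 \<le> \<delta> i" using assms by (auto simp: modification_def)
  obtain i where i: "i < m" "\<delta> i \<noteq> 0" using assms by (auto simp: modification_def)
  have "\<delta> i \<le> total \<delta>" unfolding total_def using nn i by (intro member_le_sum) auto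
  thus "0 < total \<delta>" using nn[OF i(1)] i by simp
  show "0 \<le> \<delta> 0" using nn m by simp
  show "\<delta> 0 \<le> total \<delta>" unfolding total_def using nn m by (intro member_le_sum) auto
qed

text \<open>Dividing \<open>moving_poly\<close> by its factor \<open>x\<close> and by the nonzero \<open>\<Prod>v\<in>V - {0}. x - v\<close> leaves the
  function \<open>G\<close>, and \<open>G 0 > 0\<close> because the nonconstant modes satisfy \<open>fourier_w k \<le> W\<close>.\<close>

lemma moving_poly_near_0:
  assumes \<delta>: "modification m \<delta>" and c: "0 < c" "c \<le> a 1"
  obtains x where "0 < x" "x < c" "0 < poly (moving_poly \<delta>) x * poly (root_poly (V - {0})) x"
proof -
  define T where "T = total \<delta>"
  have T: "0 < T" "0 \<le> \<delta> 0" "\<delta> 0 \<le> T" using modification_total[OF \<delta>] by (auto simp: T_def)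
  have ak: "a 1 \<le> a k" if "k \<in> {1..<n}" for k using alpha_2_least(1)[OF n, of k] that by simp
  \<comment> \<open>The linear term is mode 0 after division by \<open>x\<close>; the poles of the
    other modes lie at \<open>a 1\<close> or beyond.\<close>
  define G where "G x = q x - (T * (x - real m - W) + \<delta> 0 * W) / real n +
      (\<Sum>k=1..<n. (T * q x - (T - \<delta> 0 * x) * fourier_w k) / (a k - x)) / real n" for x
  have factor: "poly (moving_poly \<delta>) x = x * poly (root_poly (V - {0})) x * G x"
    if x: "0 < x" "x < a 1" for x
  proof -
    define P where "P = poly (root_poly (V - {0})) x"
    have xV: "x \<notin> V" using V_cases x by force
    have PV: "poly (root_poly V) x = x * P"
      using root_poly_remove[OF V_finite V_0, of x] by (simp add: P_def)
    have Pk: "poly (root_poly (V - {a k})) x = x * P / (x - a k)" if "k < n" for k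
      using root_poly_remove[OF V_finite V_mem[OF that], of x] xV V_mem[OF that] by (auto simp: PV)
    let ?f = "\<lambda>k. poly (root_poly (V - {a k})) x * (T * q x - (T - \<delta> 0 * x) * fourier_w k)"
    have "(\<Sum>k<n. ?f k) = ?f 0 + (\<Sum>k=1..<n. ?f k)"
      using n by (intro sum_lessThan_remove_zero) simp
    also have "?f 0 = x * P * (T * (x - real m - W) + \<delta> 0 * W)"
      by (simp add: P_def fourier_w_0 q_def power2_eq_square algebra_simps)
    also have "(\<Sum>k=1..<n. ?f k) =
        (\<Sum>k=1..<n. - (x * P) * ((T * q x - (T - \<delta> 0 * x) * fourier_w k) / (a k - x)))"
    proof (rule sum.cong[OF refl])
      fix k assume k: "k \<in> {1..<n}"
      have "P' / (x - y) * F = - P' * (F / (y - x))" if "x < y" for P' F y :: real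
        using that by (simp add: divide_simps) (simp add: algebra_simps)
      from this[of "a k"] show "?f k = - (x * P) * ((T * q x - (T - \<delta> 0 * x) * fourier_w k) / (a k - x))"
        using Pk[of k] k ak[OF k] x by simp
    qed
    also have "\<dots> = - (x * P) * (\<Sum>k=1..<n. (T * q x - (T - \<delta> 0 * x) * fourier_w k) / (a k - x))"
      by (rule sum_distrib_left[symmetric])
    finally have sum: "(\<Sum>k<n. ?f k) = \<dots> + x * P * (T * (x - real m - W) + \<delta> 0 * W)" by simp
    have "y * Q - (- y * A + y * B) / N = y * (Q - B / N + A / N)" for y Q A B N :: real
      by (simp add: add_divide_distrib diff_divide_distrib algebra_simps)
    thus ?thesis
      unfolding poly_moving_poly T_def[symmetric] sum PV P_def[symmetric] G_def .
  qed
  have "0 < G 0"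
  proof -
    have "0 \<le> (T * W - T * fourier_w k) / a k" if "k \<in> {1..<n}" for k
      using T fourier_w_le[of k] ak[OF that] a_1_pos by (simp add: mult_left_mono)
    hence "0 \<le> (\<Sum>k=1..<n. (T * W - T * fourier_w k) / a k)" by (rule sum_nonneg)
    moreover have "0 \<le> T * real m + W * (T - \<delta> 0)" using T W_pos by simp
    hence "T * (0 - real m - W) + \<delta> 0 * W \<le> 0" by (simp add: algebra_simps)
    ultimately have "(T * (0 - real m - W) + \<delta> 0 * W) / real n \<le> 0"
      "0 \<le> (\<Sum>k=1..<n. (T * W - T * fourier_w k) / a k) / real n"
      by (simp_all only: divide_nonneg_nonneg divide_nonpos_nonneg of_nat_0_le_iff)
    thus ?thesis using W_pos by (simp add: G_def q_def)
  qed
  moreover have "G \<midarrow>0\<rightarrow> G 0"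
    unfolding G_def q_def using ak a_1_pos n by (intro tendsto_intros) force+
  ultimately obtain r where r: "r > 0" "\<And>x. x \<noteq> 0 \<Longrightarrow> \<bar>0 - x\<bar> < r \<Longrightarrow> 0 < G x"
    using LIM_fun_gt_zero[of G "G 0" 0] by auto
  define x where "x = min (r / 2) (c / 2)"
  have x: "0 < x" "x < c" "x < r" using r c by (auto simp: x_def)
  have "x < a 1" using x c by simp
  have "x \<notin> V - {0}" using V_cases x c by force
  hence "poly (root_poly (V - {0})) x \<noteq> 0" using V_finite by (simp add: poly_root_poly_eq_0)
  \<comment> \<open>Multiplying by the unknown sign of the product twice leaves the positive sign of
    \<open>G\<close>.\<close>
  hence "0 < x * (poly (root_poly (V - {0})) x)\<^sup>2 * G x" using r(2)[of x] x by simp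
  hence "0 < poly (moving_poly \<delta>) x * poly (root_poly (V - {0})) x"
    unfolding factor[OF x(1) \<open>x < a 1\<close>] by (simp add: power2_eq_square mult_ac)
  thus thesis using that x by blast
qed

section \<open>Bounds for the second eigenvalue\<close>

lemma char_poly_L_Gp_roots:
  "poly (moving_poly \<delta>) x = 0 \<Longrightarrow> poly (char_poly (L_Gp n m w \<delta>)) x = 0"
  "poly (char_poly (L_Gp n m w \<delta>)) (a 1) = 0"
proof -
  show "poly (moving_poly \<delta>) x = 0 \<Longrightarrow> poly (char_poly (L_Gp n m w \<delta>)) x = 0"
    by (simp add: char_poly_L_Gp)
  \<comment> \<open>The repeated copy of \<open>a 1\<close>, at index \<open>n - 1\<close>, sits in
    the fixed factor and so remains an eigenvalue under every modification.\<close>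
  have "n - 1 \<in> {n div 2<..<n}" using n by auto
  moreover have "a 1 - a (n - 1) = 0" using alpha_even_reflect[of 1 n] n by simp
  ultimately have "(\<Prod>k\<in>{n div 2<..<n}. a 1 - a k) = 0" by (intro prod_zero bexI) auto
  thus "poly (char_poly (L_Gp n m w \<delta>)) (a 1) = 0"
    by (simp add: char_poly_L_Gp poly_prod)
qed

lemma Re_lambda2_two_roots_L_Gp:
  assumes "\<And>x y. x \<le> y \<Longrightarrow> P y \<Longrightarrow> P x" "x \<noteq> 0"
    and "poly (char_poly (L_Gp n m w \<delta>)) x = 0" "P 0" "P x"
  shows "P (Re (lambda2 (L_Gp n m w \<delta>)))"
  by (rule Re_lambda2_two_roots[OF L_Gp_carrier, where P = P and a = 0 and b = x])
     (use assms n char_poly_L_Gp_roots(1)[OF moving_poly_at_0] in auto)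

lemma Re_lambda2_le_a_1: "Re (lambda2 (L_Gp n m w \<delta>)) \<le> a 1"
  by (rule Re_lambda2_two_roots_L_Gp[of "\<lambda>x. x \<le> a 1" "a 1"])
     (use a_1_pos char_poly_L_Gp_roots(2) in auto)

text \<open>No element of \<open>V\<close> lies in \<open>(0, c)\<close>, so the sign of
  \<open>moving_poly\<close> near 0 is that of \<open>root_poly (V - {0})\<close> at 0. The opposite
  sign at \<open>c\<close> forces a root strictly between, next to the root 0.\<close>

lemma Re_lambda2_less:
  assumes \<delta>: "modification m \<delta>" and c: "0 < c" "c \<le> a 1"
    and neg: "poly (moving_poly \<delta>) c * poly (root_poly (V - {0})) 0 < 0"
  shows "Re (lambda2 (L_Gp n m w \<delta>)) < c"
proof -
  obtain x where x: "0 < x" "x < c" "0 < poly (moving_poly \<delta>) x * poly (root_poly (V - {0})) x"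
    using moving_poly_near_0[OF \<delta> c] .
  have "0 < poly (root_poly (V - {0})) x * poly (root_poly (V - {0})) 0"
    unfolding poly_root_poly
  proof (rule prod_same_side_pos)
    fix r assume "r \<in> V - {0}"
    hence "x < r" using V_cases[of r] x c by auto
    thus "0 < (x - r) * (0 - r)" using x by (intro mult_neg_neg) auto
  qed
  hence "poly (moving_poly \<delta>) x * poly (moving_poly \<delta>) c < 0"
    using x(3) neg by (auto simp: zero_less_mult_iff mult_less_0_iff)
  then obtain y where y: "x < y" "y < c" "poly (moving_poly \<delta>) y = 0"
    using poly_IVT[OF x(2)] by blast
  show ?thesis
    by (rule Re_lambda2_two_roots_L_Gp[of "\<lambda>x. x < c" y])
       (use x y c char_poly_L_Gp_roots(1) in auto)
qed

text \<open>The eigenvalues are \<open>m - 2\<close> ones, the repeated cycle values and the roots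
  \<open>f r\<close>. Setting aside \<open>f 0\<close>, the continuation of the root 0, a bound on
  all others bounds the second eigenvalue.\<close>

lemma spectrum_L_Gp_upward:
  assumes fac: "moving_poly \<delta> = (\<Prod>r\<in>R. [:- f r, 1:])"
    and up: "\<And>x y. x \<le> y \<Longrightarrow> P x \<Longrightarrow> P y" and P: "P 1" "P (a 1)" "\<And>r. r \<in> R - {0} \<Longrightarrow> P (f r)"
  shows "spectrum (complex_mat (L_Gp n m w \<delta>)) \<subseteq> \<real>"
    "lambda2 (L_Gp n m w \<delta>) = of_real (Re (lambda2 (L_Gp n m w \<delta>)))"
    "P (Re (lambda2 (L_Gp n m w \<delta>)))"
proof -
  define E where "E S = replicate_mset (m - 2) 1 + image_mset a (mset_set {n div 2<..<n}) +
    image_mset f (mset_set S)" for S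
  have R0: "0 \<in> R" using V_0 by (simp add: R_def)
  have "(\<Prod>x\<in>#E R. [:- x, 1:]) = char_poly (L_Gp n m w \<delta>)"
    unfolding char_poly_L_Gp fac E_def
    by (simp add: prod_unfold_prod_mset image_mset.compositionality comp_def)
  hence cp: "char_poly (L_Gp n m w \<delta>) = (\<Prod>x\<in>#E R. [:- x, 1:])" ..
  obtain xs where xs: "mset xs = E R" using ex_mset by blast
  have "n + m \<ge> 2" using n by simp
  note spec = real_char_poly_spectrum[OF L_Gp_carrier this cp xs]
  show "spectrum (complex_mat (L_Gp n m w \<delta>)) \<subseteq> \<real>" by (rule spec)
  show "lambda2 (L_Gp n m w \<delta>) = of_real (Re (lambda2 (L_Gp n m w \<delta>)))"
    unfolding spec(2) by simp
  have "P (sort xs ! 1)"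
  proof (rule sort_second_upward)
    show "mset xs = add_mset (f 0) (E (R - {0}))"
      unfolding xs E_def mset_set.remove[OF R_finite R0] by simp
    show "E (R - {0}) \<noteq> {#}" using m by (simp add: E_def)
    fix x assume "x \<in># E (R - {0})"
    hence "x = 1 \<or> x \<in> a ` {n div 2<..<n} \<or> x \<in> f ` (R - {0})"
      using R_finite by (auto simp: E_def split: if_splits)
    moreover have "a 1 \<le> x" if "x \<in> a ` {n div 2<..<n}"
    proof -
      obtain k where "n div 2 < k" "k < n" "x = a k" using \<open>x \<in> a ` {n div 2<..<n}\<close> by auto
      thus ?thesis using alpha_2_least(1)[OF n, of k] by simp
    qed
    ultimately show "P x" using P up by blast
  qed (rule up)
  thus "P (Re (lambda2 (L_Gp n m w \<delta>)))" unfolding spec(2) by simp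
qed

text \<open>The lower bound is \<open>spectrum_L_Gp_upward\<close> with unmoved roots; the upper
  bound comes from the two roots 0 and \<open>c\<close>.\<close>

lemma lambda2_L_G:
  assumes "\<beta> \<notin> V" "c \<in> R" "0 < c" "c \<le> 1" "c \<le> a 1" "\<And>r. r \<in> R - {0} \<Longrightarrow> c \<le> r"
  shows "lambda2 (L_G n m w) = of_real c"
proof -
  have fac: "moving_poly (\<lambda>_. 0) = (\<Prod>r\<in>R. [:- id r, 1:])" by (simp add: moving_poly_zero[OF assms(1)])
  note up = spectrum_L_Gp_upward[OF fac, of "\<lambda>x. c \<le> x"]
  have "c \<le> Re (lambda2 (L_Gp n m w (\<lambda>_. 0)))" by (rule up(3)) (use assms in auto)
  moreover have "poly (moving_poly (\<lambda>_. 0)) c = 0"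
    unfolding fac using assms(2) R_finite by (auto simp: poly_prod)
  hence "Re (lambda2 (L_Gp n m w (\<lambda>_. 0))) \<le> c"
    by (intro Re_lambda2_two_roots_L_Gp[of "\<lambda>x. x \<le> c" c] char_poly_L_Gp_roots(1)) (use assms in auto)
  moreover have "lambda2 (L_Gp n m w (\<lambda>_. 0)) = of_real (Re (lambda2 (L_Gp n m w (\<lambda>_. 0))))"
    by (rule up(2)) (use assms in auto)
  ultimately show ?thesis unfolding L_Gp_zero by simp
qed

text \<open>At a fixed point the change of the value is linear in \<delta> and bounded by
  \<open>total \<delta> * K\<close>, because \<open>\<delta> 0 \<le> total \<delta>\<close>; below
  the threshold it cannot reverse the sign.\<close>

lemma moving_poly_small_perturbation:
  assumes "poly (root_poly V) x * q x \<noteq> 0" (is "?p \<noteq> 0")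
  obtains \<epsilon> where "\<epsilon> > 0" "\<And>\<delta>. modification m \<delta> \<Longrightarrow> total \<delta> < \<epsilon> \<Longrightarrow> 0 < poly (moving_poly \<delta>) x * ?p"
proof -
  define h where "h k = poly (root_poly (V - {a k})) x" for k
  define K where "K = (\<Sum>k<n. \<bar>h k\<bar> * (\<bar>q x\<bar> + (1 + \<bar>x\<bar>) * \<bar>fourier_w k\<bar>)) / real n"
  have K: "0 \<le> K" unfolding K_def by (intro divide_nonneg_nonneg sum_nonneg) auto
  \<comment> \<open>The threshold divides by \<open>K + 1\<close> because \<open>K\<close> may be
    zero.\<close>
  show thesis
  proof (rule that[of "\<bar>?p\<bar> / (K + 1)"])
    show "0 < \<bar>?p\<bar> / (K + 1)" using assms K by (intro divide_pos_pos) auto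
    fix \<delta> assume \<delta>: "modification m \<delta>" "total \<delta> < \<bar>?p\<bar> / (K + 1)"
    note T = modification_total[OF \<delta>(1)]
    define D where "D = (\<Sum>k<n. h k * (total \<delta> * q x - (total \<delta> - \<delta> 0 * x) * fourier_w k)) / real n"
    have "\<bar>h k * (total \<delta> * q x - (total \<delta> - \<delta> 0 * x) * fourier_w k)\<bar> \<le>
        total \<delta> * (\<bar>h k\<bar> * (\<bar>q x\<bar> + (1 + \<bar>x\<bar>) * \<bar>fourier_w k\<bar>))" for k
    proof -
      have "\<bar>\<delta> 0 * x\<bar> \<le> total \<delta> * \<bar>x\<bar>" using T by (simp add: abs_mult mult_right_mono)
      hence "\<bar>total \<delta> - \<delta> 0 * x\<bar> \<le> total \<delta> * (1 + \<bar>x\<bar>)"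
        using T abs_triangle_ineq4[of "total \<delta>" "\<delta> 0 * x"] by (simp add: distrib_left)
      hence "\<bar>(total \<delta> - \<delta> 0 * x) * fourier_w k\<bar> \<le> total \<delta> * (1 + \<bar>x\<bar>) * \<bar>fourier_w k\<bar>"
        unfolding abs_mult by (intro mult_right_mono) auto
      moreover have "\<bar>total \<delta> * q x\<bar> = total \<delta> * \<bar>q x\<bar>" using T by (simp add: abs_mult)
      ultimately have "\<bar>total \<delta> * q x - (total \<delta> - \<delta> 0 * x) * fourier_w k\<bar> \<le>
          total \<delta> * (\<bar>q x\<bar> + (1 + \<bar>x\<bar>) * \<bar>fourier_w k\<bar>)"
        using abs_triangle_ineq4[of "total \<delta> * q x" "(total \<delta> - \<delta> 0 * x) * fourier_w k"]
        unfolding distrib_left[of "total \<delta>" "\<bar>q x\<bar>"] mult.assoc[symmetric] by linarith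
      hence "\<bar>h k\<bar> * \<bar>total \<delta> * q x - (total \<delta> - \<delta> 0 * x) * fourier_w k\<bar> \<le>
          \<bar>h k\<bar> * (total \<delta> * (\<bar>q x\<bar> + (1 + \<bar>x\<bar>) * \<bar>fourier_w k\<bar>))"
        by (intro mult_left_mono) auto
      thus ?thesis unfolding abs_mult[of "h k"] mult.left_commute[of "total \<delta>" "\<bar>h k\<bar>"] .
    qed
    hence "\<bar>D\<bar> \<le> total \<delta> * K"
      unfolding D_def K_def abs_divide abs_of_nat times_divide_eq_right sum_distrib_left
      by (intro divide_right_mono order_trans[OF sum_abs] sum_mono) auto
    also have "\<dots> \<le> total \<delta> * (K + 1)" using T by simp
    also have "\<dots> < \<bar>?p\<bar>" using \<delta>(2) K by (simp add: pos_less_divide_eq)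
    finally have less: "\<bar>D\<bar> < \<bar>?p\<bar>" .
    have "D * ?p \<le> \<bar>D\<bar> * \<bar>?p\<bar>" by (metis abs_ge_self abs_mult)
    also have "\<dots> < \<bar>?p\<bar> * \<bar>?p\<bar>" using less assms by (intro mult_strict_right_mono) auto
    also have "\<dots> = ?p * ?p" by (rule abs_mult_self_eq)
    finally have "D * ?p < ?p * ?p" .
    moreover have "poly (moving_poly \<delta>) x = ?p - D" unfolding poly_moving_poly D_def h_def ..
    ultimately show "0 < poly (moving_poly \<delta>) x * ?p" by (simp only: left_diff_distrib diff_gt_0_iff_gt)
  qed
qed

end

subsection \<open>Small modifications\<close>

lemma uniform_threshold:
  fixes P :: "'a \<Rightarrow> real \<Rightarrow> bool"
  assumes "finite F" "\<And>x. x \<in> F \<Longrightarrow> \<exists>\<epsilon>>0. \<forall>t<\<epsilon>. P x t"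
  shows "\<exists>\<epsilon>>0. \<forall>x\<in>F. \<forall>t<\<epsilon>. P x t"
proof -
  obtain e where e: "\<And>x. x \<in> F \<Longrightarrow> e x > 0 \<and> (\<forall>t<e x. P x t)" using assms(2) by metis
  have "\<forall>x\<in>F. \<forall>t<Min (insert 1 (e ` F)). P x t" using e assms(1) by simp
  moreover have "Min (insert 1 (e ` F)) > 0" using e assms(1) by simp
  ultimately show ?thesis by blast
qed

section \<open>Local perturbation and the signs that decide the direction\<close>

context cycle_star
begin

lemma R_nonneg: "r \<in> R \<Longrightarrow> r \<noteq> 0 \<Longrightarrow> r = \<beta> \<or> a 1 \<le> r"
  using V_cases[of r] V_le_4[OF V_mem[of 1]] q_roots n by (auto simp: R_def)

text \<open>Only the finitely many test points \<open>r - \<eta>\<close> and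
  \<open>r + \<eta>\<close> need their signs preserved, so one threshold suffices for
  \<open>perturbed_simple_roots\<close>. The point \<open>c\<close> will be \<open>a 1\<close> or
  \<beta>, the least positive root.\<close>

lemma local_perturbation:
  assumes b: "\<beta> \<notin> V" and c: "c \<in> R" "0 < c" "c < 1" "c \<le> a 1" "\<And>r. r \<in> R - {0} \<Longrightarrow> c \<le> r"
  obtains \<epsilon> where "\<epsilon> > 0"
    "\<And>\<delta>. modification m \<delta> \<Longrightarrow> total \<delta> < \<epsilon> \<Longrightarrow>
       spectrum (complex_mat (L_Gp n m w \<delta>)) \<subseteq> \<real> \<and>
       lambda2 (L_Gp n m w \<delta>) = of_real (Re (lambda2 (L_Gp n m w \<delta>))) \<and>
       (poly (moving_poly \<delta>) c * (\<Prod>r\<in>R - {c}. c - r) < 0 \<longrightarrow>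
         c \<le> Re (lambda2 (L_Gp n m w \<delta>)) \<and> (c < a 1 \<longrightarrow> c < Re (lambda2 (L_Gp n m w \<delta>))))"
proof -
  obtain \<eta> where \<eta>: "\<eta> > 0" "\<And>r r'. r \<in> R \<Longrightarrow> r' \<in> R \<Longrightarrow> r \<noteq> r' \<Longrightarrow> 2 * \<eta> < \<bar>r - r'\<bar>"
    using finite_separation[OF R_finite] by blast
  define F where "F = (\<lambda>r. r - \<eta>) ` R \<union> (\<lambda>r. r + \<eta>) ` R"
  have F: "x \<notin> R" if "x \<in> F" for x
  proof
    assume "x \<in> R"
    moreover obtain r where "r \<in> R" "\<bar>x - r\<bar> = \<eta>" using \<open>x \<in> F\<close> \<eta>(1) by (auto simp: F_def)
    ultimately show False using \<eta>(1) \<eta>(2)[of x r] by (cases "x = r") auto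
  qed
  have "finite F" by (simp add: F_def R_finite)
  \<comment> \<open>The variable \<open>t\<close> stands for the total of \<delta>, so that the
    minimum over test points is taken uniformly in \<delta>.\<close>
  moreover have "\<exists>\<epsilon>>0. \<forall>t<\<epsilon>. \<forall>\<delta>. modification m \<delta> \<and> total \<delta> = t \<longrightarrow>
      0 < poly (moving_poly \<delta>) x * (\<Prod>r\<in>R. x - r)" if "x \<in> F" for x
  proof -
    have "(\<Prod>r\<in>R. x - r) \<noteq> 0" using F[OF that] R_finite by (auto simp: prod_zero_iff)
    thus ?thesis unfolding prod_R[OF b] using moving_poly_small_perturbation[of x] by metis
  qed
  ultimately have "\<exists>\<epsilon>>0. \<forall>x\<in>F. \<forall>t<\<epsilon>. \<forall>\<delta>. modification m \<delta> \<and> total \<delta> = t \<longrightarrow>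
      0 < poly (moving_poly \<delta>) x * (\<Prod>r\<in>R. x - r)"
    by (rule uniform_threshold)
  then obtain \<epsilon> where \<epsilon>: "\<epsilon> > 0" "\<And>x \<delta>. x \<in> F \<Longrightarrow> modification m \<delta> \<Longrightarrow> total \<delta> < \<epsilon> \<Longrightarrow>
      0 < poly (moving_poly \<delta>) x * (\<Prod>r\<in>R. x - r)"
    by blast
  show thesis
  proof (rule that[OF \<epsilon>(1)])
    fix \<delta> assume \<delta>: "modification m \<delta>" "total \<delta> < \<epsilon>"
    have near: "0 < poly (moving_poly \<delta>) x * (\<Prod>r\<in>R. x - r)" if "r \<in> R" "x = r - \<eta> \<or> x = r + \<eta>" for r x
      using \<epsilon>(2)[of x \<delta>] that \<delta> by (auto simp: F_def)
    have "\<exists>f. moving_poly \<delta> = (\<Prod>r\<in>R. [:- f r, 1:]) \<and> (\<forall>r\<in>R. \<bar>f r - r\<bar> < \<eta>) \<and>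
        (\<forall>r\<in>R. poly (moving_poly \<delta>) r * (\<Prod>r'\<in>R - {r}. r - r') < 0 \<longrightarrow> r < f r)"
      by (rule perturbed_simple_roots[OF R_finite \<eta>(1)])
         (rule \<eta>(2) monic_moving_poly[OF b] near; assumption)+
    then obtain f where f: "moving_poly \<delta> = (\<Prod>r\<in>R. [:- f r, 1:])" "\<And>r. r \<in> R \<Longrightarrow> \<bar>f r - r\<bar> < \<eta>"
      "\<And>r. r \<in> R \<Longrightarrow> poly (moving_poly \<delta>) r * (\<Prod>r'\<in>R - {r}. r - r') < 0 \<Longrightarrow> r < f r"
      by blast
    note spec = spectrum_L_Gp_upward[OF f(1)]
    \<comment> \<open>The fixed eigenvalue \<open>a 1\<close> allows only a weak bound when
      \<open>c = a 1\<close>.\<close>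
    let ?P = "\<lambda>x. c \<le> x \<and> (c < a 1 \<longrightarrow> c < x)"
    have "?P (Re (lambda2 (L_Gp n m w \<delta>)))"
      if neg: "poly (moving_poly \<delta>) c * (\<Prod>r\<in>R - {c}. c - r) < 0"
    proof (rule spec(3))
      fix r assume r: "r \<in> R - {0}"
      \<comment> \<open>Roots starting above \<open>c\<close> stay above it by separation; the one
        starting at \<open>c\<close> moves right by the sign condition.\<close>
      have "c < f r"
      proof (cases "r = c")
        case False
        hence "2 * \<eta> < r - c" using \<eta>(2)[of r c] c(1) c(5)[OF r] r by auto
        thus ?thesis using f(2)[of r] r \<eta>(1) by auto
      qed (use f(3)[OF c(1) neg] in simp)
      thus "?P (f r)" by simp
    qed (use c in auto)
    moreover have "spectrum (complex_mat (L_Gp n m w \<delta>)) \<subseteq> \<real>" by (rule spec(1)[of "\<lambda>_. True"]) auto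
    moreover have "lambda2 (L_Gp n m w \<delta>) = of_real (Re (lambda2 (L_Gp n m w \<delta>)))"
      by (rule spec(2)[of "\<lambda>_. True"]) auto
    ultimately show "spectrum (complex_mat (L_Gp n m w \<delta>)) \<subseteq> \<real> \<and>
       lambda2 (L_Gp n m w \<delta>) = of_real (Re (lambda2 (L_Gp n m w \<delta>))) \<and>
       (poly (moving_poly \<delta>) c * (\<Prod>r\<in>R - {c}. c - r) < 0 \<longrightarrow>
         c \<le> Re (lambda2 (L_Gp n m w \<delta>)) \<and> (c < a 1 \<longrightarrow> c < Re (lambda2 (L_Gp n m w \<delta>))))"
      by blast
  qed
qed

text \<open>By \<open>moving_poly_at_a_1\<close> the value carries the sign of
  \<open>- S_coeff\<close> times the product of the other cycle factors; it remains to compare that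
  product with the reference signs.\<close>

lemma sign_at_a_1:
  assumes "\<beta> \<notin> V" "q (a 1) > 0"
  shows "S_coeff n m w \<delta> < 0 \<Longrightarrow> poly (moving_poly \<delta>) (a 1) * poly (root_poly (V - {0})) 0 < 0"
    and "S_coeff n m w \<delta> > 0 \<Longrightarrow> poly (moving_poly \<delta>) (a 1) * (\<Prod>r\<in>R - {a 1}. a 1 - r) < 0"
proof -
  let ?P = "poly (root_poly (V - {a 1})) (a 1)"
  have V1: "a 1 \<in> V" using V_mem[of 1] n by simp
  have P0: "?P \<noteq> 0" using V_finite by (simp add: poly_root_poly_eq_0)
  have at: "poly (moving_poly \<delta>) (a 1) = - (2 / real n) * ?P * q (a 1) * S_coeff n m w \<delta>"
    using assms(2) by (intro moving_poly_at_a_1) simp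
  have n0: "2 / real n > 0" using n by simp
  \<comment> \<open>All remaining elements of \<open>V\<close> exceed \<open>a 1\<close>, so their
    factors match in sign; the leftover factors \<open>a 1 - 0\<close> and \<open>0 - a 1\<close>
    are opposite.\<close>
  have "0 < poly (root_poly (V - {a 1} - {0})) (a 1) * poly (root_poly (V - {0} - {a 1})) 0"
    unfolding poly_root_poly Diff_insert2[symmetric] insert_commute[of "a 1"]
  proof (rule prod_same_side_pos)
    fix r assume r: "r \<in> V - {0, a 1}"
    thus "0 < (a 1 - r) * (0 - r)" using V_cases[of r] a_1_pos by (intro mult_neg_neg) auto
  qed
  moreover have "?P = a 1 * poly (root_poly (V - {a 1} - {0})) (a 1)"
    using root_poly_remove[of "V - {a 1}" 0 "a 1"] V_finite V_0 a_1_pos by simp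
  moreover have "poly (root_poly (V - {0})) 0 = - (a 1) * poly (root_poly (V - {0} - {a 1})) 0"
    using root_poly_remove[of "V - {0}" "a 1" 0] V_finite V1 a_1_pos by simp
  ultimately have neg: "?P * poly (root_poly (V - {0})) 0 < 0"
    using a_1_pos by (simp add: mult.left_commute[of _ "a 1"] mult.assoc mult_less_0_iff zero_less_mult_iff)
  {
    assume S: "S_coeff n m w \<delta> < 0"
    have "poly (moving_poly \<delta>) (a 1) * poly (root_poly (V - {0})) 0 =
        (2 / real n * q (a 1) * - S_coeff n m w \<delta>) * (?P * poly (root_poly (V - {0})) 0)"
      unfolding at by (simp add: mult_ac)
    also have "\<dots> < 0" using S n0 assms(2) by (intro mult_pos_neg mult_pos_pos neg) auto
    finally show "poly (moving_poly \<delta>) (a 1) * poly (root_poly (V - {0})) 0 < 0" .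
  }
  {
    assume S: "S_coeff n m w \<delta> > 0"
    have "R - {a 1} = insert \<beta> (insert \<beta>' (V - {a 1}))"
      using assms \<beta>'_notin V1 by (auto simp: R_def)
    hence "(\<Prod>r\<in>R - {a 1}. a 1 - r) = q (a 1) * ?P"
      using assms(1) \<beta>'_notin V_finite by (simp add: q_roots(1) poly_root_poly)
    hence "poly (moving_poly \<delta>) (a 1) * (\<Prod>r\<in>R - {a 1}. a 1 - r) =
        - (2 / real n * (?P * ?P) * (q (a 1) * q (a 1)) * S_coeff n m w \<delta>)"
      unfolding at by (simp add: mult_ac)
    moreover have PP: "0 < ?P * ?P" using P0 by (auto simp: zero_less_mult_iff linorder_neq_iff)
    have QQ: "0 < q (a 1) * q (a 1)" using assms(2) by simp
    have "0 < 2 / real n * (?P * ?P) * (q (a 1) * q (a 1)) * S_coeff n m w \<delta>"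
      by (rule mult_pos_pos[OF mult_pos_pos[OF mult_pos_pos[OF n0 PP] QQ] S])
    ultimately show "poly (moving_poly \<delta>) (a 1) * (\<Prod>r\<in>R - {a 1}. a 1 - r) < 0" by simp
  }
qed

text \<open>The value at \<beta> has the sign of the cosine sum times the product over
  \<open>V\<close>. In the second comparison the negative sign comes from the extra factor
  \<open>\<beta> - \<beta>'\<close>.\<close>

lemma sign_at_\<beta>:
  assumes \<beta>: "\<beta> \<notin> V" "\<beta> < a 1" and t: "t = pi - arccos ((\<beta> - 2) / 2)" and \<delta>: "modification m \<delta>"
  defines "\<Sigma> \<equiv> \<Sum>i<n. w i * cos ((real n / 2 - real i) * t)"
  shows "\<Sigma> < 0 \<Longrightarrow> poly (moving_poly \<delta>) \<beta> * poly (root_poly (V - {0})) 0 < 0"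
    and "\<Sigma> > 0 \<Longrightarrow> poly (moving_poly \<delta>) \<beta> * (\<Prod>r\<in>R - {\<beta>}. \<beta> - r) < 0"
proof -
  let ?P = "poly (root_poly V) \<beta>"
  obtain d where d: "d > 0"
    "poly (moving_poly \<delta>) \<beta> = ?P * ((total \<delta> - \<delta> 0 * \<beta>) * \<Sigma> / d)"
    using moving_poly_at_\<beta>[OF \<beta> t] unfolding \<Sigma>_def by metis
  \<comment> \<open>Since \<beta> < 1 and the total is positive, the prefactor stays strictly
    positive even if all weight sits on \<open>\<delta> 0\<close>.\<close>
  have "\<delta> 0 * \<beta> \<le> \<delta> 0" using modification_total[OF \<delta>] q_roots by (intro mult_left_le) auto
  moreover have "\<delta> 0 * \<beta> < total \<delta>" if "\<delta> 0 = total \<delta>"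
    using that modification_total(1)[OF \<delta>] q_roots(3) by simp
  ultimately have pos: "0 < total \<delta> - \<delta> 0 * \<beta>" using modification_total(3)[OF \<delta>] by fastforce
  have P0: "?P \<noteq> 0" using \<beta>(1) V_finite by (simp add: poly_root_poly_eq_0)
  have "0 < poly (root_poly (V - {0})) \<beta> * poly (root_poly (V - {0})) 0"
    unfolding poly_root_poly
  proof (rule prod_same_side_pos)
    fix r assume "r \<in> V - {0}"
    hence "a 1 \<le> r" using V_cases[of r] by auto
    thus "0 < (\<beta> - r) * (0 - r)" using \<beta> a_1_pos by (intro mult_neg_neg) linarith+
  qed
  moreover have "?P = \<beta> * poly (root_poly (V - {0})) \<beta>"
    using root_poly_remove[OF V_finite V_0, of \<beta>] by simp
  ultimately have PP: "0 < ?P * poly (root_poly (V - {0})) 0"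
    using q_roots(2) by (simp add: mult.assoc)
  {
    assume S: "\<Sigma> < 0"
    have "(total \<delta> - \<delta> 0 * \<beta>) * \<Sigma> / d < 0"
      using S pos d(1) by (intro divide_neg_pos mult_pos_neg)
    hence "(?P * poly (root_poly (V - {0})) 0) * ((total \<delta> - \<delta> 0 * \<beta>) * \<Sigma> / d) < 0"
      using PP by (intro mult_pos_neg)
    thus "poly (moving_poly \<delta>) \<beta> * poly (root_poly (V - {0})) 0 < 0"
      unfolding d(2) by (simp only: mult_ac)
  }
  {
    assume S: "\<Sigma> > 0"
    have "0 < ?P * ?P" using P0 by (auto simp: zero_less_mult_iff linorder_neq_iff)
    moreover have "0 < (total \<delta> - \<delta> 0 * \<beta>) * \<Sigma> / d"
      using S pos d(1) by (intro divide_pos_pos mult_pos_pos)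
    ultimately have "0 < ?P * ?P * ((total \<delta> - \<delta> 0 * \<beta>) * \<Sigma> / d)" by (rule mult_pos_pos)
    moreover have "\<beta> - \<beta>' < 0" using q_roots by simp
    ultimately have "(?P * ?P * ((total \<delta> - \<delta> 0 * \<beta>) * \<Sigma> / d)) * (\<beta> - \<beta>') < 0"
      by (rule mult_pos_neg)
    moreover have "R - {\<beta>} = insert \<beta>' V" using \<beta>(1) \<beta>'_notin by (auto simp: R_def)
    hence "(\<Prod>r\<in>R - {\<beta>}. \<beta> - r) = (\<beta> - \<beta>') * ?P"
      using \<beta>'_notin V_finite by (simp add: poly_root_poly)
    ultimately show "poly (moving_poly \<delta>) \<beta> * (\<Prod>r\<in>R - {\<beta>}. \<beta> - r) < 0"
      unfolding d(2) by (simp only: mult_ac)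
  }
qed

text \<open>Below \<open>alpha n 1\<close> one has \<open>n * t < pi\<close>, so every angle lies
  strictly within a quarter turn of 0; \<open>w 0 > 0\<close> makes the sum strictly
  positive.\<close>

lemma cos_sum_pos:
  assumes "\<beta> < alpha n 1" and t: "t = pi - arccos ((\<beta> - 2) / 2)"
  shows "0 < (\<Sum>i<n. w i * cos ((real n / 2 - real i) * t))"
proof (rule sum_pos2)
  have "1 \<le> n" using n by simp
  note b = pi_minus_arccos_bounds[OF this q_roots(2) assms(1) this t]
  have "0 < cos ((real n / 2 - real i) * t)" if "i < n" for i
  proof -
    have "\<bar>real n / 2 - real i\<bar> * t \<le> real n / 2 * t"
      using that b(2) by (intro mult_right_mono) (auto simp: abs_if)
    also have "\<dots> < pi / 2" using b(3) by simp
    finally have "\<bar>(real n / 2 - real i) * t\<bar> < pi / 2" using b(2) by (simp add: abs_mult)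
    thus ?thesis by (intro cos_gt_zero_pi) (auto simp: abs_less_iff)
  qed
  note pos = this
  show "0 < w 0 * cos ((real n / 2 - real 0) * t)" using w0 pos[of 0] n by simp
  show "0 \<le> w i * cos ((real n / 2 - real i) * t)" if "i \<in> {..<n}" for i
    using that w_nonneg pos[of i] by simp
qed (use n in auto)

section \<open>The spectral gap on either side of \<open>alpha n 2\<close>\<close>

lemma a_1_in_R: "a 1 \<in> R" using V_mem[of 1] n by (simp add: R_def)

text \<open>Here \<open>a 1\<close> is the least positive root and lies left of both roots of
  \<open>q\<close>, so \<open>q (a 1) > 0\<close>. For positive \<open>S_coeff\<close> the local
  lower bound meets the upper bound \<open>a 1\<close> valid for all modifications; for negative
  \<open>S_coeff\<close> the sign change gives a smaller eigenvalue without any smallness.\<close>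

lemma spectral_gap_alpha_2:
  assumes "\<beta> \<notin> V" "a 1 < \<beta>"
  shows "lambda2 (L_G n m w) = of_real (a 1)"
    and "\<exists>\<epsilon>>0. \<forall>\<delta>. modification m \<delta> \<and> total \<delta> < \<epsilon> \<longrightarrow>
      spectrum (complex_mat (L_Gp n m w \<delta>)) \<subseteq> \<real> \<and>
      (S_coeff n m w \<delta> > 0 \<longrightarrow> lambda2 (L_Gp n m w \<delta>) = of_real (a 1))"
    and "modification m \<delta> \<Longrightarrow> S_coeff n m w \<delta> < 0 \<Longrightarrow> Re (lambda2 (L_Gp n m w \<delta>)) < a 1"
proof -
  have c: "a 1 \<in> R" "0 < a 1" "a 1 < 1" "a 1 \<le> a 1" "\<And>r. r \<in> R - {0} \<Longrightarrow> a 1 \<le> r"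
    using a_1_in_R a_1_pos assms(2) q_roots R_nonneg by force+
  have qa: "q (a 1) > 0" unfolding q_roots(1) using assms q_roots c by (intro mult_neg_neg) auto
  note sgn = sign_at_a_1[OF assms(1) qa]
  show "lambda2 (L_G n m w) = of_real (a 1)" using c by (intro lambda2_L_G assms) auto
  obtain \<epsilon> where \<epsilon>: "\<epsilon> > 0" "\<And>\<delta>. modification m \<delta> \<Longrightarrow> total \<delta> < \<epsilon> \<Longrightarrow>
       spectrum (complex_mat (L_Gp n m w \<delta>)) \<subseteq> \<real> \<and>
       lambda2 (L_Gp n m w \<delta>) = of_real (Re (lambda2 (L_Gp n m w \<delta>))) \<and>
       (poly (moving_poly \<delta>) (a 1) * (\<Prod>r\<in>R - {a 1}. a 1 - r) < 0 \<longrightarrow>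
         a 1 \<le> Re (lambda2 (L_Gp n m w \<delta>)) \<and> (a 1 < a 1 \<longrightarrow> a 1 < Re (lambda2 (L_Gp n m w \<delta>))))"
    using local_perturbation[OF assms(1) c] by blast
  have "lambda2 (L_Gp n m w \<delta>) = of_real (a 1)"
    if "modification m \<delta>" "total \<delta> < \<epsilon>" "S_coeff n m w \<delta> > 0" for \<delta>
    using \<epsilon>(2)[OF that(1,2)] sgn(2)[OF that(3)] Re_lambda2_le_a_1[of \<delta>] by (metis order_antisym)
  thus "\<exists>\<epsilon>>0. \<forall>\<delta>. modification m \<delta> \<and> total \<delta> < \<epsilon> \<longrightarrow>
      spectrum (complex_mat (L_Gp n m w \<delta>)) \<subseteq> \<real> \<and>
      (S_coeff n m w \<delta> > 0 \<longrightarrow> lambda2 (L_Gp n m w \<delta>) = of_real (a 1))"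
    using \<epsilon> by blast
  show "modification m \<delta> \<Longrightarrow> S_coeff n m w \<delta> < 0 \<Longrightarrow> Re (lambda2 (L_Gp n m w \<delta>)) < a 1"
    using Re_lambda2_less[OF _ c(2,4) sgn(1)] by blast
qed

text \<open>Now \<beta> is the least positive root and lies strictly below the fixed eigenvalue
  \<open>a 1\<close>, so the sign of the cosine sum gives strict inequalities in both
  directions.\<close>

lemma spectral_gap_beta:
  assumes "\<beta> \<notin> V" "\<beta> < a 1" and t: "t = pi - arccos ((\<beta> - 2) / 2)"
  defines "\<Sigma> \<equiv> \<Sum>i<n. w i * cos ((real n / 2 - real i) * t)"
  shows "lambda2 (L_G n m w) = of_real \<beta>"
    and "\<exists>\<epsilon>>0. \<forall>\<delta>. modification m \<delta> \<and> total \<delta> < \<epsilon> \<longrightarrow>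
      spectrum (complex_mat (L_Gp n m w \<delta>)) \<subseteq> \<real> \<and>
      (\<Sigma> > 0 \<longrightarrow> \<beta> < Re (lambda2 (L_Gp n m w \<delta>))) \<and>
      (\<Sigma> < 0 \<longrightarrow> Re (lambda2 (L_Gp n m w \<delta>)) < \<beta>)"
proof -
  have c: "\<beta> \<in> R" "0 < \<beta>" "\<beta> < 1" "\<beta> \<le> a 1" "\<And>r. r \<in> R - {0} \<Longrightarrow> \<beta> \<le> r"
    using assms(2) q_roots R_nonneg by (force simp: R_def)+
  note sgn = sign_at_\<beta>[OF assms(1,2) t, folded \<Sigma>_def]
  show "lambda2 (L_G n m w) = of_real \<beta>" using c by (intro lambda2_L_G assms) auto
  obtain \<epsilon> where \<epsilon>: "\<epsilon> > 0" "\<And>\<delta>. modification m \<delta> \<Longrightarrow> total \<delta> < \<epsilon> \<Longrightarrow>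
       spectrum (complex_mat (L_Gp n m w \<delta>)) \<subseteq> \<real> \<and>
       lambda2 (L_Gp n m w \<delta>) = of_real (Re (lambda2 (L_Gp n m w \<delta>))) \<and>
       (poly (moving_poly \<delta>) \<beta> * (\<Prod>r\<in>R - {\<beta>}. \<beta> - r) < 0 \<longrightarrow>
         \<beta> \<le> Re (lambda2 (L_Gp n m w \<delta>)) \<and> (\<beta> < a 1 \<longrightarrow> \<beta> < Re (lambda2 (L_Gp n m w \<delta>))))"
    using local_perturbation[OF assms(1) c] by blast
  have "Re (lambda2 (L_Gp n m w \<delta>)) < \<beta>" if "modification m \<delta>" "\<Sigma> < 0" for \<delta>
    by (rule Re_lambda2_less[OF that(1) c(2,4) sgn(1)[OF that]])
  moreover have "\<beta> < Re (lambda2 (L_Gp n m w \<delta>))" if "modification m \<delta>" "total \<delta> < \<epsilon>" "\<Sigma> > 0" for \<delta>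
    using \<epsilon>(2)[OF that(1,2)] sgn(2)[OF that(1,3)] assms(2) by blast
  ultimately show "\<exists>\<epsilon>>0. \<forall>\<delta>. modification m \<delta> \<and> total \<delta> < \<epsilon> \<longrightarrow>
      spectrum (complex_mat (L_Gp n m w \<delta>)) \<subseteq> \<real> \<and>
      (\<Sigma> > 0 \<longrightarrow> \<beta> < Re (lambda2 (L_Gp n m w \<delta>))) \<and>
      (\<Sigma> < 0 \<longrightarrow> Re (lambda2 (L_Gp n m w \<delta>)) < \<beta>)"
    using \<epsilon> by blast
qed

end

theorem theoremC:
  fixes n m :: nat and w :: "nat \<Rightarrow> real" and \<beta> \<theta> :: real
  assumes "n \<ge> 3" and "m \<ge> 4"
    and "\<forall>i<n. w i \<ge> 0" and "w 0 > 0"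
    and \<beta>: "\<beta> = beta_minus m (\<Sum>i<n. w i)"
    and "\<beta> \<notin> {alpha n l | l. l \<le> n}"
    and \<theta>: "\<theta> = pi - arccos ((\<beta> - 2) / 2)"
  shows
    "(\<exists>\<epsilon>>0. \<forall>\<delta>. modification m \<delta> \<and> 0 < (\<Sum>i<m. \<delta> i) \<and> (\<Sum>i<m. \<delta> i) < \<epsilon> \<longrightarrow>
        spectrum (complex_mat (L_Gp n m w \<delta>)) \<subseteq> \<real> \<and>
        (alpha n 2 < \<beta> \<and> S_coeff n m w \<delta> < 0 \<longrightarrow>
           Re (lambda2 (L_Gp n m w \<delta>)) < Re (lambda2 (L_G n m w))) \<and>
        (alpha n 2 < \<beta> \<and> S_coeff n m w \<delta> > 0 \<longrightarrow>
           lambda2 (L_Gp n m w \<delta>) = lambda2 (L_G n m w)) \<and>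
        (0 < \<beta> \<and> \<beta> < alpha n 1 \<longrightarrow>
           Re (lambda2 (L_Gp n m w \<delta>)) > Re (lambda2 (L_G n m w))) \<and>
        (alpha n 1 < \<beta> \<and> \<beta> < alpha n 2 \<and>
         (\<Sum>i<n. w i * cos ((real n / 2 - real i) * \<theta>)) > 0 \<longrightarrow>
           Re (lambda2 (L_Gp n m w \<delta>)) > Re (lambda2 (L_G n m w))) \<and>
        (alpha n 1 < \<beta> \<and> \<beta> < alpha n 2 \<and>
         (\<Sum>i<n. w i * cos ((real n / 2 - real i) * \<theta>)) < 0 \<longrightarrow>
           Re (lambda2 (L_Gp n m w \<delta>)) < Re (lambda2 (L_G n m w)))) \<and>
     (\<forall>\<delta>. modification m \<delta> \<and> alpha n 2 < \<beta> \<longrightarrow>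
        (S_coeff n m w \<delta> < 0 \<longrightarrow>
           Re (lambda2 (L_Gp n m w \<delta>)) < Re (lambda2 (L_G n m w))) \<and>
        (S_coeff n m w \<delta> > 0 \<longrightarrow>
           Re (lambda2 (L_Gp n m w \<delta>)) \<le> Re (lambda2 (L_G n m w))))"
proof -
  interpret cs: cycle_star n m w by unfold_locales (use assms in auto)
  have \<beta>': "cs.\<beta> = \<beta>" by (simp add: cs.\<beta>_def cs.W_def \<beta>)
  have V: "\<beta> \<notin> cs.V"
  proof
    assume "\<beta> \<in> cs.V"
    then obtain k where "k \<le> n div 2" "\<beta> = alpha n (2 * k)" by (auto simp: cs.V_eq(1))
    thus False using assms(6) by auto
  qed
  have "2 \<le> n" using assms(1) by simp
  hence "alpha n 2 \<noteq> \<beta>" using assms(6) by blast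
  then consider "alpha n 2 < \<beta>" | "\<beta> < alpha n 2" by linarith
  thus ?thesis
  proof cases
    case 1
    \<comment> \<open>This rules out the hypotheses that place \<beta> below
      \<open>alpha n 1\<close>.\<close>
    have "alpha n 1 < alpha n 2" using assms(1) by (intro alpha_strict_mono) auto
    note above = cs.spectral_gap_alpha_2[unfolded \<beta>' mult_1_right, OF V 1]
    show ?thesis
      using above cs.Re_lambda2_le_a_1 1 \<open>alpha n 1 < alpha n 2\<close> unfolding cs.total_def by force
  next
    case 2
    note below = cs.spectral_gap_beta[unfolded \<beta>' mult_1_right, OF V 2 \<theta>]
    \<comment> \<open>The regime below \<open>alpha n 1\<close> is thereby an instance of the
      positive cosine sum.\<close>
    have "0 < (\<Sum>i<n. w i * cos ((real n / 2 - real i) * \<theta>))" if "\<beta> < alpha n 1"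
      using cs.cos_sum_pos[unfolded \<beta>', OF that \<theta>] .
    thus ?thesis
      using below 2 unfolding cs.total_def by auto
  qed
qed

end
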